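(* Let $\alpha\ge0$, let $\{\varphi_j\}_{j=1}^n$ be scalar zero-mean functions in $H^1(\mathbb T^2)$ that are orthonormal in $\dot H^1_\alpha$, i.e. $$(\varphi_i,\varphi_j)+\alpha(\nabla\varphi_i,\nabla\varphi_j)=\delta_{ij},\qquad i,j=1,\dots,n,$$ and set $v_j=\nabla^\perp\Delta^{-1}\varphi_j$ and $$\rho(x)=\sum_{j=1}^n|v_j(x)|^2=\sum_{j=1}^n|\nabla\Delta^{-1}\varphi_j(x)|^2.$$ Then for every $\Lambda\in\mathbb N$, $$\|\rho\|_{L_\infty}^{1/2}\le4\sqrt2\,\pi\,(\ln4e\Lambda)^{1/2}+4\Lambda^{-1/2}\left(|\mathbb T^2|\sum_{j=1}^n\|\nabla\varphi_j\|^2\right)^{1/2}.$$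
   Context: $\mathbb T^2=[0,2\pi]^2$ is the torus, $|\mathbb T^2|=4\pi^2$; $(\cdot,\cdot)$ and $\|\cdot\|$ are the $L_2(\mathbb T^2)$ scalar product and norm. $\dot H^1_\alpha$ is the space of zero-mean functions in $H^1(\mathbb T^2)$ with scalar product $(\varphi,\psi)_\alpha=(\varphi,\psi)+\alpha(\nabla\varphi,\nabla\psi)$. $\Delta^{-1}$ is the inverse of the Laplacian on zero-mean functions, and $\nabla^\perp=(-\partial_2,\partial_1)$ (the gradient rotated by $\pi/2$; the sign is immaterial). $\ln4e\Lambda$ means $\ln(4e\Lambda)$ and $\mathbb N=\{1,2,3,\dots\}$. *)

theory Defs
  imports "HOL-Probability.Probability"
begin

text \<open>A function on the torus is represented by a function on the plane of which only the
  values on the square \<open>[0,2\<pi>]\<^sup>2\<close> matter, and these only up to null sets.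
  Periodicity enters through the test functions.\<close>

definition torus :: "(real \<times> real) measure" where
  "torus = lebesgue_on (cbox (0, 0) (2 * pi, 2 * pi))"

definition torus_L2 :: "(real \<times> real \<Rightarrow> 'a::euclidean_space) \<Rightarrow> bool" where
  "torus_L2 f \<longleftrightarrow> f \<in> borel_measurable torus \<and> integrable torus (\<lambda>x. (norm (f x))\<^sup>2)"

definition torus_inner :: "(real \<times> real \<Rightarrow> 'a::euclidean_space) \<Rightarrow> (real \<times> real \<Rightarrow> 'a) \<Rightarrow> real" where
  "torus_inner f g = (\<integral>x. f x \<bullet> g x \<partial>torus)"

definition torus_norm :: "(real \<times> real \<Rightarrow> 'a::euclidean_space) \<Rightarrow> real" where
  "torus_norm f = sqrt (torus_inner f f)"

definition torus_Linf_norm :: "(real \<times> real \<Rightarrow> real) \<Rightarrow> ereal" where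
  "torus_Linf_norm f = esssup torus (\<lambda>x. ereal \<bar>f x\<bar>)"

definition zero_mean :: "(real \<times> real \<Rightarrow> real) \<Rightarrow> bool" where
  "zero_mean f \<longleftrightarrow> (\<integral>x. f x \<partial>torus) = 0"

definition dir_deriv :: "real \<times> real \<Rightarrow> (real \<times> real \<Rightarrow> real) \<Rightarrow> real \<times> real \<Rightarrow> real" where
  "dir_deriv u f = (\<lambda>x. frechet_derivative f (at x) u)"

text \<open>The smooth functions are those all of whose iterated directional derivatives exist and
  are differentiable everywhere.\<close>

definition torus_test :: "(real \<times> real \<Rightarrow> real) \<Rightarrow> bool" where
  "torus_test \<eta> \<longleftrightarrow>
     (\<forall>us x. foldr dir_deriv us \<eta> differentiable (at x)) \<and>
     (\<forall>x. \<eta> (x + (2 * pi, 0)) = \<eta> x \<and> \<eta> (x + (0, 2 * pi)) = \<eta> x)"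

definition weak_grad :: "(real \<times> real \<Rightarrow> real) \<Rightarrow> (real \<times> real \<Rightarrow> real \<times> real) \<Rightarrow> bool" where
  "weak_grad f g \<longleftrightarrow> torus_L2 g \<and>
     (\<forall>\<eta>. torus_test \<eta> \<longrightarrow> (\<forall>u\<in>Basis.
        torus_inner f (dir_deriv u \<eta>) = - torus_inner (\<lambda>x. g x \<bullet> u) \<eta>))"

definition torus_H1 :: "(real \<times> real \<Rightarrow> real) \<Rightarrow> bool" where
  "torus_H1 f \<longleftrightarrow> torus_L2 f \<and> (\<exists>g. weak_grad f g)"

text \<open>The weak gradient is determined up to null sets; an arbitrary representative is chosen.
  The same applies to the inverse Laplacian below.\<close>

definition grad :: "(real \<times> real \<Rightarrow> real) \<Rightarrow> real \<times> real \<Rightarrow> real \<times> real" where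
  "grad f = (SOME g. weak_grad f g)"

definition weak_laplacian :: "(real \<times> real \<Rightarrow> real) \<Rightarrow> (real \<times> real \<Rightarrow> real) \<Rightarrow> bool" where
  "weak_laplacian f h \<longleftrightarrow> torus_L2 h \<and>
     (\<forall>\<eta>. torus_test \<eta> \<longrightarrow>
        torus_inner f (\<lambda>x. \<Sum>u\<in>Basis. dir_deriv u (dir_deriv u \<eta>) x) = torus_inner h \<eta>)"

definition inv_laplacian :: "(real \<times> real \<Rightarrow> real) \<Rightarrow> real \<times> real \<Rightarrow> real" where
  "inv_laplacian \<phi> = (SOME \<psi>. torus_H1 \<psi> \<and> zero_mean \<psi> \<and> weak_laplacian \<psi> \<phi>)"

definition perp :: "real \<times> real \<Rightarrow> real \<times> real" where
  "perp a = (- snd a, fst a)"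

lemma norm_perp: "norm (perp a) = norm a"
  by (cases a) (simp add: perp_def norm_Pair add.commute)

definition grad_perp :: "(real \<times> real \<Rightarrow> real) \<Rightarrow> real \<times> real \<Rightarrow> real \<times> real" where
  "grad_perp f = (\<lambda>x. perp (grad f x))"

definition H1_inner :: "real \<Rightarrow> (real \<times> real \<Rightarrow> real) \<Rightarrow> (real \<times> real \<Rightarrow> real) \<Rightarrow> real" where
  "H1_inner \<alpha> \<phi> \<psi> = torus_inner \<phi> \<psi> + \<alpha> * torus_inner (grad \<phi>) (grad \<psi>)"

end

theory Submission
  imports Defs
begin

text \<open>
  Expand \<open>\<phi>\<^sub>j\<close> into a Fourier series with coefficients \<open>c\<^sub>j k\<close>. Then \<open>\<nabla>\<Delta>\<^sup>-\<^sup>1\<phi>\<^sub>j\<close> has the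
  coefficients \<open>- \<i> k c\<^sub>j k / |k|\<^sup>2\<close>, which are absolutely summable because \<open>|k| c\<^sub>j k\<close> and \<open>1 / |k|\<^sup>2\<close>
  are square summable over \<open>k \<noteq> 0\<close>. Split the sum at \<open>max |k\<^sub>1| |k\<^sub>2| = \<Lambda>\<close>. The \<open>L\<^sub>2\<close> Gram matrix of a
  system that is orthonormal in \<open>H\<^sup>1\<^sub>\<alpha>\<close> is at most the identity, so that Bessel's inequality holds for
  it; hence the low modes contribute to \<open>\<rho>\<close> at most a multiple of \<open>\<Sum> 1 / |k|\<^sup>2\<close> over
  \<open>0 < max |k\<^sub>1| |k\<^sub>2| \<le> \<Lambda>\<close>, which is logarithmic in \<open>\<Lambda>\<close>. For the high modes the Cauchy--Schwarz
  inequality gives \<open>\<Sum>\<^sub>j \<parallel>\<nabla>\<phi>\<^sub>j\<parallel>\<^sup>2\<close> times the sum of \<open>1 / |k|\<^sup>4\<close> over the remaining modes, which is at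
  most \<open>8 / \<Lambda>\<close>. Minkowski's inequality combines the two parts.
\<close>

section \<open>Integration on the torus and its characters\<close>

text \<open>Two obstacles shape the proof. The weight 1/|k|^2 just fails to be summable over the
  planar lattice: this forces the cutoff and produces the logarithm. And \<open>grad\<close> and
  \<open>inv_laplacian\<close> are arbitrary choices, known only through weak identities and up to
  null sets; to bound \<open>\<rho>\<close> almost everywhere, the components of the velocity have
  to be identified with absolutely convergent series. That rests on the uniqueness theorem for
  Fourier coefficients of integrable functions, and on an explicit weak solution showing that the
  choice in \<open>inv_laplacian\<close> is not void. The low modes get a bound independent of n by
  duality: at a fixed point they are pairings of \<open>\<phi> j\<close> with a trigonometric
  polynomial that does not depend on j, so that Bessel's inequality can be summed over j. Both parts
  come out with the constant 2/pi^2 under the root, well below the constants of the theorem, and the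
  final step is a crude comparison.\<close>

lemma space_torus: "space torus = cbox (0, 0) (2 * pi, 2 * pi)"
  by (simp add: torus_def)

lemma finite_measure_torus: "finite_measure torus"
  unfolding torus_def
  by (intro finite_measure_lebesgue_on) (simp add: lmeasurable_cbox)

interpretation torus: finite_measure torus
  by (rule finite_measure_torus)

lemma measure_space_torus: "measure torus (space torus) = 4 * pi\<^sup>2"
proof -
  have "measure torus (space torus) = measure lebesgue (cbox (0, 0) (2 * pi, 2 * pi))"
    unfolding space_torus torus_def by (subst measure_restrict_space) auto
  also have "\<dots> = 4 * pi\<^sup>2"
    by (simp add: measure_completion content_Pair power2_eq_square)
  finally show ?thesis .
qed

lemma integrable_torus_continuous:
  fixes f :: "real \<times> real \<Rightarrow> 'b::euclidean_space"
  assumes "continuous_on UNIV f"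
  shows "integrable torus f"
  unfolding torus_def
  by (intro continuous_imp_integrable continuous_on_subset[OF assms]) simp

lemma borel_measurable_torus_continuous:
  fixes f :: "real \<times> real \<Rightarrow> 'b::euclidean_space"
  assumes "continuous_on UNIV f"
  shows "f \<in> borel_measurable torus"
  using integrable_torus_continuous[OF assms] by (rule borel_measurable_integrable)

lemma torus_integral_eq_integral:
  fixes f :: "real \<times> real \<Rightarrow> 'b::euclidean_space"
  assumes "continuous_on UNIV f"
  shows "integral\<^sup>L torus f = integral (cbox (0, 0) (2 * pi, 2 * pi)) f"
  using integrable_torus_continuous[OF assms] unfolding torus_def
  by (intro lebesgue_integral_eq_integral) auto

lemma Basis_real_prod: "(Basis :: (real \<times> real) set) = {(1, 0), (0, 1)}"
  by (auto simp: Basis_prod_def zero_prod_def)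

text \<open>By Fubini the integral in the direction \<open>u\<close> can be done innermost; the
  fundamental theorem of calculus leaves a difference of boundary values, which periodicity cancels.
  It serves both for the orthogonality of characters and for integration by parts.\<close>

lemma torus_integral_derivative:
  fixes F :: "real \<times> real \<Rightarrow> 'b::euclidean_space"
  assumes der: "\<And>x. (F has_derivative D x) (at x)"
    and cont: "continuous_on UNIV (\<lambda>x. D x u)"
    and per: "\<And>x. F (x + (2 * pi, 0)) = F x" "\<And>x. F (x + (0, 2 * pi)) = F x"
    and u: "u \<in> Basis"
  shows "(\<integral>x. D x u \<partial>torus) = 0"
proof -
  let ?I = "cbox 0 (2 * pi) :: real set"
  \<comment> \<open>The path \<open>\<gamma>\<close> stands for a horizontal or a vertical segment
    across the square, so that one computation covers both directions.\<close>
  have ftc: "integral ?I (\<lambda>s. D (\<gamma> s) u) = 0"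
    if \<gamma>: "\<And>s. (\<gamma> has_vector_derivative u) (at s)" and e: "F (\<gamma> (2 * pi)) = F (\<gamma> 0)" for \<gamma>
  proof -
    have "((\<lambda>s. F (\<gamma> s)) has_vector_derivative D (\<gamma> s) u) (at s within {0..2 * pi})" for s
    proof -
      have "((\<lambda>s. F (\<gamma> s)) has_derivative (\<lambda>t. D (\<gamma> s) (t *\<^sub>R u))) (at s)"
        using has_derivative_compose[OF \<gamma>[of s, unfolded has_vector_derivative_def] der[of "\<gamma> s"]] .
      moreover have "D (\<gamma> s) (t *\<^sub>R u) = t *\<^sub>R D (\<gamma> s) u" for t
        using has_derivative_linear[OF der[of "\<gamma> s"]] by (rule linear_cmul)
      ultimately show ?thesis
        by (auto simp: has_vector_derivative_def intro: has_derivative_at_withinI)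
    qed
    then have "((\<lambda>s. D (\<gamma> s) u) has_integral F (\<gamma> (2 * pi)) - F (\<gamma> 0)) {0..2 * pi}"
      by (intro fundamental_theorem_of_calculus) auto
    then show ?thesis using e by (simp add: integral_unique)
  qed
  have eq: "(\<integral>x. D x u \<partial>torus)
      = integral ?I (\<lambda>s. integral ?I (\<lambda>t. D (s, t) u))"
    unfolding torus_integral_eq_integral[OF cont]
    by (intro integral_prod_continuous continuous_on_subset[OF cont]) simp
  consider "u = (1, 0)" | "u = (0, 1)" using u by (auto simp: Basis_real_prod)
  then show ?thesis
  proof cases
    case 1
    \<comment> \<open>The iterated integral has the second coordinate innermost; the horizontal
      direction needs the other order.\<close>
    have "integral ?I (\<lambda>s. integral ?I (\<lambda>t. D (s, t) u))
        = integral ?I (\<lambda>t. integral ?I (\<lambda>s. D (s, t) u))"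
      by (rule integral_swap_continuous)
        (use continuous_on_subset[OF cont] in \<open>simp add: case_prod_unfold\<close>)
    also have "(\<lambda>t. integral ?I (\<lambda>s. D (s, t) u)) = (\<lambda>t. 0)"
    proof
      fix t
      show "integral ?I (\<lambda>s. D (s, t) u) = 0"
        using per(1)[of "(0, t)"] unfolding 1
        by (intro ftc[unfolded 1]) (auto intro!: derivative_eq_intros simp: has_vector_derivative_def)
    qed
    finally show ?thesis using eq by simp
  next
    case 2
    have "(\<lambda>s. integral ?I (\<lambda>t. D (s, t) u)) = (\<lambda>t. 0)"
    proof
      fix s
      show "integral ?I (\<lambda>t. D (s, t) u) = 0"
        using per(2)[of "(s, 0)"] unfolding 2
        by (intro ftc[unfolded 2]) (auto intro!: derivative_eq_intros simp: has_vector_derivative_def)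
    qed
    then show ?thesis using eq by simp
  qed
qed

section \<open>Characters of the torus and Fourier coefficients\<close>

definition kdot :: "int \<times> int \<Rightarrow> real \<times> real \<Rightarrow> real" where
  "kdot k x = of_int (fst k) * fst x + of_int (snd k) * snd x"

definition chr :: "int \<times> int \<Rightarrow> real \<times> real \<Rightarrow> complex" where
  "chr k x = cis (kdot k x)"

lemma kdot_simps:
  "kdot (k + l) x = kdot k x + kdot l x" "kdot (- k) x = - kdot k x" "kdot 0 x = 0"
  "kdot k (x + y) = kdot k x + kdot k y" "kdot k (x - y) = kdot k x - kdot k y"
  by (auto simp: kdot_def algebra_simps)

lemma norm_chr [simp]: "norm (chr k x) = 1"
  by (simp add: chr_def)

lemma chr_mult: "chr k x * chr l x = chr (k + l) x"
  by (simp add: chr_def cis_mult kdot_simps)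

lemma chr_uminus: "chr (- k) x = cnj (chr k x)"
  by (simp add: chr_def cis_cnj kdot_simps)

lemma chr_add: "chr k (x + y) = chr k x * chr k y"
  by (simp add: chr_def cis_mult kdot_simps)

lemma chr_0 [simp]: "chr 0 x = 1"
  by (simp add: chr_def kdot_simps)

lemma has_derivative_kdot [derivative_intros]: "(kdot k has_derivative kdot k) F"
proof -
  have "bounded_linear (kdot k)"
    unfolding kdot_def
    by (intro bounded_linear_add bounded_linear_const_mult bounded_linear_fst bounded_linear_snd)
  then show ?thesis by (rule bounded_linear_imp_has_derivative)
qed

lemma has_derivative_chr: "(chr k has_derivative (\<lambda>h. \<i> * of_real (kdot k h) * chr k x)) (at x)"
proof -
  have "((\<lambda>x. \<i> * of_real (kdot k x)) has_derivative (\<lambda>h. \<i> * of_real (kdot k h))) (at x)"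
    by (intro has_derivative_mult_right has_derivative_of_real has_derivative_kdot)
  from has_derivative_compose[OF this DERIV_exp[unfolded has_field_derivative_def]]
  have "((\<lambda>x. exp (\<i> * of_real (kdot k x))) has_derivative
      (\<lambda>h. \<i> * of_real (kdot k h) * exp (\<i> * of_real (kdot k x)))) (at x)"
    by (simp add: mult_ac)
  then show ?thesis by (simp add: chr_def[abs_def] cis_conv_exp)
qed

lemma continuous_on_chr [continuous_intros]: "continuous_on S (chr k)"
  by (rule has_derivative_continuous_on, rule has_derivative_at_withinI, rule has_derivative_chr)

lemma chr_periodic: "chr k (x + (2 * pi, 0)) = chr k x" "chr k (x + (0, 2 * pi)) = chr k x"
proof -
  have *: "cis (of_int m * (2 * pi)) = 1" for m
    using cis_multiple_2pi[of "of_int m"] by (simp add: mult.commute)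
  show "chr k (x + (2 * pi, 0)) = chr k x" "chr k (x + (0, 2 * pi)) = chr k x"
    using *[of "fst k"] *[of "snd k"]  
    by (simp_all add: chr_add) (simp_all add: chr_def kdot_def)
qed

text \<open>If \<open>k \<noteq> 0\<close>, some coordinate direction \<open>u\<close> has
  \<open>kdot k u \<noteq> 0\<close>; up to this factor and the imaginary unit the character is its
  own derivative along \<open>u\<close>, and such a derivative integrates to 0.\<close>

lemma torus_integral_chr: "(\<integral>x. chr k x \<partial>torus) = (if k = 0 then 4 * pi\<^sup>2 else 0)"
proof (cases "k = 0")
  case True
  then show ?thesis by (simp add: measure_space_torus scaleR_conv_of_real)
next
  case False
  then obtain u where u: "u \<in> Basis" "kdot k u \<noteq> 0"
    by (force simp: Basis_real_prod kdot_def prod_eq_iff)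
  have "(\<integral>x. \<i> * of_real (kdot k u) * chr k x \<partial>torus) = 0"
    by (rule torus_integral_derivative[where F = "chr k"
          and D = "\<lambda>x h. \<i> * of_real (kdot k h) * chr k x"])
      (rule has_derivative_chr chr_periodic u continuous_intros)+
  then show ?thesis using u False by simp
qed

text \<open>Unnormalised: the factor 1/(4 pi^2) is put into the coefficients handed to
  \<open>series\<close> instead.\<close>

definition fcoeff :: "(real \<times> real \<Rightarrow> complex) \<Rightarrow> int \<times> int \<Rightarrow> complex" where
  "fcoeff f k = (\<integral>x. f x * chr (- k) x \<partial>torus)"

lemma integrable_mult_chr:
  assumes "integrable torus f"
  shows "integrable torus (\<lambda>x. f x * chr k x)"
proof (rule Bochner_Integration.integrable_bound[OF assms])
  show "(\<lambda>x. f x * chr k x) \<in> borel_measurable torus"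
    using assms borel_measurable_torus_continuous[OF continuous_on_chr] by measurable
qed (simp add: norm_mult)

section \<open>A function is determined by its Fourier coefficients\<close>

inductive trig_poly :: "(real \<times> real \<Rightarrow> complex) \<Rightarrow> bool" where
  chr: "trig_poly (\<lambda>x. c * chr k x)"
| add: "trig_poly p \<Longrightarrow> trig_poly q \<Longrightarrow> trig_poly (\<lambda>x. p x + q x)"

lemma trig_poly_mult:
  assumes "trig_poly p" "trig_poly q"
  shows "trig_poly (\<lambda>x. p x * q x)"
  using assms(1)
proof induction
  case (chr c k)
  show ?case using assms(2)
  proof induction
    case (chr d l)
    have "(\<lambda>x. c * chr k x * (d * chr l x)) = (\<lambda>x. (c * d) * chr (k + l) x)"
      by (simp add: chr_mult[symmetric] mult_ac)
    then show ?case by (simp add: trig_poly.chr)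
  next
    case (add p q)
    then show ?case using trig_poly.add by (simp add: distrib_left)
  qed
next
  case (add p q)
  then show ?case using trig_poly.add by (simp add: distrib_right)
qed

lemma trig_poly_const: "trig_poly (\<lambda>x. c)"
  using trig_poly.chr[of c 0] by simp

lemma trig_poly_Re_chr: "trig_poly (\<lambda>x. of_real (Re (chr k x)))"
proof -
  have "trig_poly (\<lambda>x. 1/2 * chr k x + 1/2 * chr (- k) x)"
    by (intro trig_poly.intros)
  also have "(\<lambda>x. 1/2 * chr k x + 1/2 * chr (- k) x) = (\<lambda>x. of_real (Re (chr k x)))"
    by (simp add: fun_eq_iff chr_uminus complex_eq_iff)
  finally show ?thesis .
qed

lemma trig_poly_Im_chr: "trig_poly (\<lambda>x. of_real (Im (chr k x)))"
proof -
  have "trig_poly (\<lambda>x. - \<i>/2 * chr k x + \<i>/2 * chr (- k) x)"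
    by (intro trig_poly.intros)
  also have "(\<lambda>x. - \<i>/2 * chr k x + \<i>/2 * chr (- k) x) = (\<lambda>x. of_real (Im (chr k x)))"
    by (simp add: fun_eq_iff chr_uminus complex_eq_iff)
  finally show ?thesis .
qed

definition torus_emb :: "real \<times> real \<Rightarrow> complex \<times> complex" where
  "torus_emb x = (chr (1, 0) x, chr (0, 1) x)"

text \<open>The four real coordinates of \<open>torus_emb\<close> are real and imaginary parts of
  characters, and trigonometric polynomials form an algebra that contains these.\<close>

lemma trig_poly_polynomial:
  assumes "real_polynomial_function g"
  shows "trig_poly (\<lambda>x. of_real (g (torus_emb x)))"
  using assms
proof induction
  case (linear f)
  interpret bounded_linear f by fact
  have *: "f (z, w) = f (1, 0) * Re z + f (\<i>, 0) * Im z + f (0, 1) * Re w + f (0, \<i>) * Im w" for z w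
  proof -
    have "(z, w) = Re z *\<^sub>R (1, 0) + Im z *\<^sub>R (\<i>, 0) + Re w *\<^sub>R (0, 1) + Im w *\<^sub>R (0, \<i>)"
      by (simp add: complex_eq_iff)
    then have "f (z, w) = f (Re z *\<^sub>R (1, 0) + Im z *\<^sub>R (\<i>, 0) + Re w *\<^sub>R (0, 1) + Im w *\<^sub>R (0, \<i>))"
      by (rule arg_cong)
    then show ?thesis by (simp only: add scaleR) simp
  qed
  have "(\<lambda>x. complex_of_real (f (torus_emb x))) = (\<lambda>x.
      of_real (f (1, 0)) * of_real (Re (chr (1, 0) x)) + of_real (f (\<i>, 0)) * of_real (Im (chr (1, 0) x))
      + of_real (f (0, 1)) * of_real (Re (chr (0, 1) x)) + of_real (f (0, \<i>)) * of_real (Im (chr (0, 1) x)))"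
    using *[of "chr (1, 0) x" "chr (0, 1) x" for x] by (simp add: torus_emb_def del: of_real_eq_iff)
  moreover have "trig_poly \<dots>"
    by (intro trig_poly.add trig_poly_mult trig_poly_const trig_poly_Re_chr trig_poly_Im_chr)
  ultimately show ?case by simp
qed (auto intro: trig_poly_const trig_poly.add trig_poly_mult)

text \<open>Integrability is part of the claim because additivity of the integral in the induction
  step depends on it.\<close>

lemma trig_poly_orthogonal:
  assumes "trig_poly p" and f: "integrable torus f" and "\<And>k. fcoeff f k = 0"
  shows "integrable torus (\<lambda>x. f x * p x) \<and> (\<integral>x. f x * p x \<partial>torus) = 0"
  using assms(1)
proof induction
  case (chr c k)
  have "(\<integral>x. f x * chr k x \<partial>torus) = 0"
    using assms(3)[of "- k"] by (simp add: fcoeff_def)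
  then show ?case
    using integrable_mult_chr[OF f, of k] by (simp add: mult.left_commute[of _ c])
next
  case (add p q)
  then show ?case by (simp add: distrib_left)
qed

lemma cis_eq_cases:
  assumes "cis a = cis b" "a \<in> {0..2 * pi}" "b \<in> {0..2 * pi}"
  shows "a = b \<or> a \<in> {0, 2 * pi} \<and> b \<in> {0, 2 * pi}"
proof -
  have "sin a = sin b \<and> cos a = cos b"
    using assms(1) by (simp add: complex_eq_iff)
  then obtain n :: int where n: "a = b + 2 * pi * n"
    by (metis sin_cos_eq_iff)
  have "\<bar>a - b\<bar> \<le> 2 * pi"
    using assms(2,3) by auto
  then have "2 * pi * \<bar>real_of_int n\<bar> \<le> 2 * pi * 1"
    using n by (simp add: abs_mult)
  then have "\<bar>real_of_int n\<bar> \<le> 1" using pi_gt_zero by (simp only: mult_le_cancel_left_pos)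
  then have "n = 0 \<or> n = 1 \<or> n = -1" by linarith
  then show ?thesis using n assms(2,3) by auto
qed

text \<open>The closed square covers the torus with its opposite sides doubled, so injectivity fails
  only among boundary points. A function that vanishes there is therefore constant on the
  fibres.\<close>

lemma torus_emb_eq_imp:
  assumes "torus_emb x = torus_emb y" "x \<in> cbox (0, 0) (2 * pi, 2 * pi)" "y \<in> cbox (0, 0) (2 * pi, 2 * pi)"
  shows "x = y \<or> x \<notin> box (0, 0) (2 * pi, 2 * pi) \<and> y \<notin> box (0, 0) (2 * pi, 2 * pi)"
proof -
  obtain a b c d where xy: "x = (a, b)" "y = (c, d)" by (metis surj_pair)
  have r: "a \<in> {0..2 * pi}" "b \<in> {0..2 * pi}" "c \<in> {0..2 * pi}" "d \<in> {0..2 * pi}"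
    using assms(2,3) xy by (auto simp: cbox_Pair_eq)
  have "cis a = cis c" "cis b = cis d"
    using assms(1) xy by (auto simp: torus_emb_def chr_def kdot_def)
  then have "a = c \<or> a \<in> {0, 2 * pi} \<and> c \<in> {0, 2 * pi}" "b = d \<or> b \<in> {0, 2 * pi} \<and> d \<in> {0, 2 * pi}"
    using cis_eq_cases r by blast+
  then show ?thesis
    unfolding xy by (auto simp: box_def Basis_real_prod)
qed

lemma continuous_on_torus_emb: "continuous_on S torus_emb"
  unfolding torus_emb_def by (intro continuous_intros)

text \<open>Since \<open>h\<close> vanishes on the boundary of the square, it factors through the embedding of the torus
  into \<open>\<complex>\<^sup>2\<close>, where the Stone--Weierstrass theorem applies.\<close>

lemma torus_approx_trig_poly:
  fixes h :: "real \<times> real \<Rightarrow> real"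
  assumes h: "continuous_on UNIV h" "\<And>x. x \<notin> box (0, 0) (2 * pi, 2 * pi) \<Longrightarrow> h x = 0" and e: "e > 0"
  obtains p where "trig_poly p" "\<And>x. x \<in> space torus \<Longrightarrow> norm (of_real (h x) - p x) < e"
proof -
  let ?Q = "cbox (0, 0) (2 * pi, 2 * pi) :: (real \<times> real) set"
  \<comment> \<open>A continuous surjection from a compact space onto a Hausdorff space is a
    quotient map; this makes the factor \<open>H\<close> continuous.\<close>
  have q: "quotient_map (top_of_set ?Q) (top_of_set (torus_emb ` ?Q)) torus_emb"
    by (rule T1_Spaces.continuous_imp_quotient_map)
      (auto simp: compact_space_subtopology continuous_on_torus_emb intro: Hausdorff_space_subtopology)
  have "continuous_map (top_of_set ?Q) euclidean h"
    using continuous_on_subset[OF h(1)] by simp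
  from quotient_map_lift_exists[OF q this]
  obtain H where H: "continuous_map (top_of_set (torus_emb ` ?Q)) euclidean H"
      "\<And>x. x \<in> ?Q \<Longrightarrow> H (torus_emb x) = h x"
    using torus_emb_eq_imp h(2) by (metis (no_types, lifting) topspace_euclidean_subtopology)
  have "compact (torus_emb ` ?Q)"
    by (intro compact_continuous_image continuous_on_torus_emb compact_cbox)
  from Stone_Weierstrass_real_polynomial_function[OF this _ e, of H] H(1)
  obtain g where g: "real_polynomial_function g" "\<And>x. x \<in> torus_emb ` ?Q \<Longrightarrow> \<bar>H x - g x\<bar> < e"
    by auto
  show ?thesis
  proof
    show "trig_poly (\<lambda>x. of_real (g (torus_emb x)))"
      by (rule trig_poly_polynomial[OF g(1)])
    fix x assume "x \<in> space torus"
    then have x: "x \<in> ?Q" by (simp only: space_torus)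
    then have "\<bar>h x - g (torus_emb x)\<bar> < e"
      using g(2)[OF imageI[OF x]] H(2)[OF x] by simp
    then show "norm (of_real (h x) - complex_of_real (g (torus_emb x))) < e"
      by (simp flip: of_real_diff)
  qed
qed

text \<open>Replacing \<open>h\<close> by a trigonometric polynomial within \<open>e\<close> kills
  the integral and changes it by at most \<open>e\<close> times the integral of
  \<open>norm (f x)\<close>.\<close>

lemma fcoeff_eq_0_orthogonal:
  fixes h :: "real \<times> real \<Rightarrow> real"
  assumes f: "integrable torus f" "\<And>k. fcoeff f k = 0"
    and h: "continuous_on UNIV h" "\<And>x. x \<notin> box (0, 0) (2 * pi, 2 * pi) \<Longrightarrow> h x = 0"
  shows "integrable torus (\<lambda>x. f x * of_real (h x))" "(\<integral>x. f x * of_real (h x) \<partial>torus) = 0"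
proof -
  let ?C = "\<integral>x. norm (f x) \<partial>torus"
  have meas: "(\<lambda>x. complex_of_real (h x)) \<in> borel_measurable torus"
    using borel_measurable_torus_continuous[OF h(1)] by measurable
  have key: "integrable torus (\<lambda>x. f x * of_real (h x)) \<and> norm (\<integral>x. f x * of_real (h x) \<partial>torus) \<le> e * ?C"
    if e: "e > 0" for e
  proof -
    obtain p where p: "trig_poly p" "\<And>x. x \<in> space torus \<Longrightarrow> norm (of_real (h x) - p x) < e"
      using torus_approx_trig_poly[OF h e] by blast
    note fp = trig_poly_orthogonal[OF p(1) f]
    have [measurable]: "p \<in> borel_measurable torus"
      using p(1) by induction (use borel_measurable_torus_continuous[OF continuous_on_chr] in measurable)
    have bound: "norm (f x * (of_real (h x) - p x)) \<le> e * norm (f x)" if "x \<in> space torus" for x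
      using mult_left_mono[OF less_imp_le[OF p(2)[OF that]], of "norm (f x)"]
      by (simp add: norm_mult mult.commute)
    have int: "integrable torus (\<lambda>x. e * norm (f x))" using f(1) by simp
    have i1: "integrable torus (\<lambda>x. f x * (of_real (h x) - p x))"
      by (rule Bochner_Integration.integrable_bound[OF int])
        (use f(1) meas e bound in \<open>auto intro!: AE_I2 order_trans[OF bound]\<close>)
    have "integrable torus (\<lambda>x. f x * (of_real (h x) - p x) + f x * p x)"
      using i1 fp by simp
    then have i2: "integrable torus (\<lambda>x. f x * of_real (h x))"
      by (simp add: algebra_simps)
    have "(\<integral>x. f x * of_real (h x) \<partial>torus) = (\<integral>x. f x * (of_real (h x) - p x) + f x * p x \<partial>torus)"
      by (simp add: algebra_simps)
    also have "\<dots> = (\<integral>x. f x * (of_real (h x) - p x) \<partial>torus)"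
      using i1 fp by (subst Bochner_Integration.integral_add) auto
    also have "norm \<dots> \<le> (\<integral>x. e * norm (f x) \<partial>torus)"
      by (rule order_trans[OF Bochner_Integration.integral_norm_bound integral_mono]) (use i1 int bound in auto)
    finally show ?thesis using i2 by simp
  qed
  show "integrable torus (\<lambda>x. f x * of_real (h x))" using key[of 1] by simp
  have "norm (\<integral>x. f x * of_real (h x) \<partial>torus) \<le> 0 + d" if "d > 0" for d
  proof -
    have C: "?C \<ge> 0" by simp
    \<comment> \<open>The summand 1 keeps the quotient meaningful when
      \<open>?C = 0\<close>.\<close>
    have "norm (\<integral>x. f x * of_real (h x) \<partial>torus) \<le> d / (?C + 1) * ?C"
      using key[of "d / (?C + 1)"] that C by (smt (verit) divide_pos_pos)
    also have "\<dots> \<le> d"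
    proof -
      have "d / (c + 1) * c \<le> d" if "c \<ge> 0" for c
        using that \<open>d > 0\<close> by (simp add: field_simps)
      from this[OF C] show ?thesis .
    qed
    finally show ?thesis by simp
  qed
  then show "(\<integral>x. f x * of_real (h x) \<partial>torus) = 0"
    using field_le_epsilon norm_le_zero_iff by blast
qed

section \<open>Null sets in the square and vanishing almost everywhere\<close>

lemma AE_torus_not_negligible:
  assumes "negligible N"
  shows "AE x in torus. x \<notin> N"
proof -
  have "AE x in lebesgue. x \<notin> N"
    using assms by (intro AE_not_in) (simp add: negligible_iff_null_sets)
  then show ?thesis
    unfolding torus_def by (subst AE_restrict_space_iff) auto
qed

lemma AE_torus_box: "AE x in torus. x \<in> box (0, 0) (2 * pi, 2 * pi)"
proof -
  have "AE x in torus. x \<notin> cbox (0, 0) (2 * pi, 2 * pi) - box (0, 0) (2 * pi, 2 * pi)"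
    by (intro AE_torus_not_negligible negligible_frontier_interval)
  then show ?thesis using AE_space[of torus] by eventually_elim (auto simp: space_torus)
qed

text \<open>The test functions of the proof are continuous approximations of \<open>sgn f\<close>, cut off near the
  boundary of the square so that they extend periodically.\<close>

lemma AE_torus_eq_0_continuous:
  fixes f :: "real \<times> real \<Rightarrow> real"
  assumes f: "integrable torus f"
    and orth: "\<And>h. continuous_on UNIV h \<Longrightarrow> (\<And>x. x \<notin> box (0, 0) (2 * pi, 2 * pi) \<Longrightarrow> h x = (0::real))
      \<Longrightarrow> (\<integral>x. f x * h x \<partial>torus) = 0"
  shows "AE x in torus. f x = 0"
proof -
  let ?Q = "cbox (0, 0) (2 * pi, 2 * pi) :: (real \<times> real) set"
  let ?B = "box (0, 0) (2 * pi, 2 * pi) :: (real \<times> real) set"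
  have [measurable]: "f \<in> borel_measurable torus" using f by simp
  have "(\<lambda>x. sgn (f x)) \<in> borel_measurable torus" by measurable
  \<comment> \<open>Measurability in this sense supplies continuous functions on the plane that
    converge to \<open>sgn (f x)\<close> off a negligible set.\<close>
  then have "(\<lambda>x. sgn (f x)) measurable_on ?Q"
    unfolding torus_def by (subst measurable_on_iff_borel_measurable) auto
  then obtain N g where N: "negligible N" and g: "\<And>n. continuous_on UNIV (g n)"
    and lim: "\<And>x. x \<notin> N \<Longrightarrow> (\<lambda>n. g n x) \<longlonglongrightarrow> (if x \<in> ?Q then sgn (f x) else 0)"
    unfolding measurable_on_def by blast
  \<comment> \<open>The distance factor vanishes off the open square and is eventually 1 at each of
    its points. Clamping to [-1, 1] leaves the limit, a sign, unchanged and makes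
    \<open>\<bar>f x\<bar>\<close> a majorant of the products.\<close>
  define h where "h n x = min 1 (real n * infdist x (- ?B)) * max (- 1) (min 1 (g n x))" for n x
  have hcont: "continuous_on UNIV (h n)" for n
    unfolding h_def by (intro continuous_intros g)
  have h0: "h n x = 0" if "x \<notin> ?B" for n x
    using that by (simp add: h_def)
  have hle: "\<bar>h n x\<bar> \<le> 1" for n x
  proof -
    have "\<bar>min 1 (real n * infdist x (- ?B))\<bar> \<le> 1" using infdist_nonneg[of x "- ?B"] by auto
    moreover have "\<bar>max (- 1) (min 1 (g n x))\<bar> \<le> 1" by auto
    ultimately show ?thesis unfolding h_def abs_mult by (intro mult_le_one) auto
  qed
  have hlim: "(\<lambda>n. h n x) \<longlonglongrightarrow> sgn (f x)" if "x \<in> ?B" "x \<notin> N" for x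
  proof -
    have xQ: "x \<in> ?Q" using that box_subset_cbox by blast
    have "infdist x (- ?B) > 0"
    proof -
      have "- ?B \<noteq> {}" by (metis bounded_box Compl_eq_Diff_UNIV Diff_eq_empty_iff bounded_subset not_bounded_UNIV)
      then have "infdist x (- ?B) \<noteq> 0"
        using in_closed_iff_infdist_zero[of "- ?B" x] that by (simp add: closed_Compl open_box)
      then show ?thesis using infdist_nonneg[of x "- ?B"] by linarith
    qed
    then have "eventually (\<lambda>n. real n * infdist x (- ?B) \<ge> 1) sequentially"
      by real_asymp
    then have "eventually (\<lambda>n. min 1 (real n * infdist x (- ?B)) = 1) sequentially"
      by eventually_elim auto
    then have 1: "(\<lambda>n. min 1 (real n * infdist x (- ?B))) \<longlonglongrightarrow> 1"
      by (rule tendsto_eventually)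
    have "(\<lambda>n. max (- 1) (min 1 (g n x))) \<longlonglongrightarrow> max (- 1) (min 1 (sgn (f x)))"
      using lim[OF that(2)] xQ by (intro tendsto_intros) simp
    also have "max (- 1) (min 1 (sgn (f x))) = sgn (f x)" by (auto simp: sgn_if)
    finally have "(\<lambda>n. h n x) \<longlonglongrightarrow> 1 * sgn (f x)"
      unfolding h_def by (intro tendsto_mult 1)
    then show ?thesis by simp
  qed
  have "(\<lambda>n. \<integral>x. f x * h n x \<partial>torus) \<longlonglongrightarrow> (\<integral>x. f x * sgn (f x) \<partial>torus)"
  proof (rule integral_dominated_convergence)
    show "integrable torus (\<lambda>x. \<bar>f x\<bar>)" using f by simp
    show "(\<lambda>x. f x * h n x) \<in> borel_measurable torus" for n
      using borel_measurable_torus_continuous[OF hcont] by measurable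
    show "AE x in torus. (\<lambda>n. f x * h n x) \<longlonglongrightarrow> f x * sgn (f x)"
      using AE_torus_box AE_torus_not_negligible[OF N]
      by eventually_elim (intro tendsto_intros hlim)
    show "AE x in torus. norm (f x * h n x) \<le> \<bar>f x\<bar>" for n
      by (intro AE_I2) (simp add: abs_mult hle mult_left_le)
  qed measurable
  moreover have "(\<integral>x. f x * h n x \<partial>torus) = 0" for n
    by (intro orth hcont h0)
  ultimately have "(\<integral>x. f x * sgn (f x) \<partial>torus) = 0"
    by (simp add: LIMSEQ_const_iff)
  moreover have "f x * sgn (f x) = \<bar>f x\<bar>" for x by (auto simp: sgn_if)
  ultimately have "(\<integral>x. \<bar>f x\<bar> \<partial>torus) = 0" by simp
  then have "AE x in torus. \<bar>f x\<bar> = 0"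
    using f by (subst (asm) integral_nonneg_eq_0_iff_AE) auto
  then show ?thesis by simp
qed

text \<open>The functions \<open>h\<close> being real, orthogonality passes to the real and the
  imaginary part of \<open>f\<close> separately.\<close>

theorem fcoeff_eq_0_imp_AE_eq_0:
  assumes f: "integrable torus f" "\<And>k. fcoeff f k = 0"
  shows "AE x in torus. f x = 0"
proof -
  have "AE x in torus. Re (f x) = 0"
  proof (rule AE_torus_eq_0_continuous)
    fix h :: "real \<times> real \<Rightarrow> real"
    assume h: "continuous_on UNIV h" "\<And>x. x \<notin> box (0, 0) (2 * pi, 2 * pi) \<Longrightarrow> h x = 0"
    note * = fcoeff_eq_0_orthogonal[OF f h]
    show "(\<integral>x. Re (f x) * h x \<partial>torus) = 0"
      using integral_Re[OF *(1)] *(2) by simp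
  qed (use f in simp)
  moreover have "AE x in torus. Im (f x) = 0"
  proof (rule AE_torus_eq_0_continuous)
    fix h :: "real \<times> real \<Rightarrow> real"
    assume h: "continuous_on UNIV h" "\<And>x. x \<notin> box (0, 0) (2 * pi, 2 * pi) \<Longrightarrow> h x = 0"
    note * = fcoeff_eq_0_orthogonal[OF f h]
    show "(\<integral>x. Im (f x) * h x \<partial>torus) = 0"
      using integral_Im[OF *(1)] *(2) by simp
  qed (use f in simp)
  ultimately show ?thesis by eventually_elim (simp add: complex_eq_iff)
qed

section \<open>Lattice sums and absolutely convergent Fourier series\<close>

definition ksq :: "int \<times> int \<Rightarrow> real" where
  "ksq k = (of_int (fst k))\<^sup>2 + (of_int (snd k))\<^sup>2"

text \<open>Squares instead of discs: each shell has an exactly known number of points and a simple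
  lower bound for \<open>ksq\<close>, so lattice sums reduce to one-dimensional ones. Invariance
  under negation is used for reality and reindexing.\<close>

definition square :: "nat \<Rightarrow> (int \<times> int) set" where
  "square N = {- int N..int N} \<times> {- int N..int N}"

lemma ksq_nonneg [simp]: "ksq k \<ge> 0"
  by (simp add: ksq_def)

lemma ksq_eq_0_iff [simp]: "ksq k = 0 \<longleftrightarrow> k = 0"
  by (simp add: ksq_def prod_eq_iff)

lemma finite_square [simp]: "finite (square N)"
  by (simp add: square_def)

lemma square_mono: "M \<le> N \<Longrightarrow> square M \<subseteq> square N"
  by (auto simp: square_def)

lemma square_0: "square 0 = {0}"
  by (auto simp: square_def zero_prod_def)

lemma uminus_mem_square_iff [simp]: "- k \<in> square N \<longleftrightarrow> k \<in> square N"
  by (cases k) (auto simp: square_def)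

lemma finite_subset_square:
  assumes "finite A"
  obtains N where "N \<ge> 1" "A \<subseteq> square N"
proof -
  have "\<exists>N\<ge>1. A \<subseteq> square N"
    using assms
  proof induction
    case (insert k A)
    then obtain N where N: "A \<subseteq> square N" "N \<ge> 1" by auto
    have "k \<in> square (nat \<bar>fst k\<bar> + nat \<bar>snd k\<bar>)"
      by (cases k) (auto simp: square_def)
    then have "insert k A \<subseteq> square (N + (nat \<bar>fst k\<bar> + nat \<bar>snd k\<bar>))"
      using N(1) square_mono[of N "N + (nat \<bar>fst k\<bar> + nat \<bar>snd k\<bar>)"]
        square_mono[of "nat \<bar>fst k\<bar> + nat \<bar>snd k\<bar>" "N + (nat \<bar>fst k\<bar> + nat \<bar>snd k\<bar>)"]
      by auto
    then show ?case using N(2) by (meson le_add1 le_trans)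
  qed auto
  then show ?thesis using that by blast
qed

text \<open>Turns unordered sums over the lattice into limits of sequences, as dominated convergence
  demands.\<close>

lemma filterlim_square: "filterlim square (finite_subsets_at_top UNIV) sequentially"
  unfolding filterlim_finite_subsets_at_top
proof (intro allI impI)
  fix X :: "(int \<times> int) set" assume "finite X \<and> X \<subseteq> UNIV"
  then obtain N where "X \<subseteq> square N" using finite_subset_square[of X] by metis
  then show "eventually (\<lambda>n. finite (square n) \<and> X \<subseteq> square n \<and> square n \<subseteq> UNIV) sequentially"
    using square_mono by (intro eventually_sequentiallyI[of N]) auto
qed

lemma card_square: "card (square N) = (2 * N + 1) * (2 * N + 1)"
proof -
  have "nat (2 * int N + 1) = 2 * N + 1" by linarith
  then show ?thesis by (simp add: square_def card_cartesian_product)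
qed

lemma card_shell: "card (square (Suc N) - square N) = 8 * Suc N"
  by (subst card_Diff_subset[OF finite_square square_mono]) (simp_all add: card_square)

lemma ksq_shell_ge:
  assumes "k \<notin> square N"
  shows "(real (Suc N))\<^sup>2 \<le> ksq k"
proof -
  have *: "(real (Suc N))\<^sup>2 \<le> (of_int m)\<^sup>2" if "m \<notin> {- int N..int N}" for m
  proof -
    have "int (Suc N) \<le> \<bar>m\<bar>" using that by auto
    then have "real (Suc N) \<le> \<bar>of_int m\<bar>" by linarith
    then show ?thesis by (simp add: abs_le_square_iff[symmetric])
  qed
  have "fst k \<notin> {- int N..int N} \<or> snd k \<notin> {- int N..int N}"
    using assms by (cases k) (auto simp: square_def)
  then show ?thesis
    using *[of "fst k"] *[of "snd k"] zero_le_power2[of "real_of_int (fst k)"]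
      zero_le_power2[of "real_of_int (snd k)"]
    unfolding ksq_def by linarith
qed

lemma sum_shell_le:
  assumes "\<And>k. k \<in> square (Suc N) - square N \<Longrightarrow> f k \<le> (B :: real)"
  shows "(\<Sum>k\<in>square (Suc N) - square N. f k) \<le> 8 * real (Suc N) * B"
  using sum_bounded_above[of "square (Suc N) - square N" f B] assms card_shell[of N] by simp

lemma sum_square_Suc:
  "(\<Sum>k\<in>square (Suc N). f k) = (\<Sum>k\<in>square N. f k) + (\<Sum>k\<in>square (Suc N) - square N. (f k :: real))"
  using sum.subset_diff[OF square_mono[of N "Suc N"], of f] by simp

text \<open>The shell at distance m has 8m points with \<open>ksq k\<close> at least m^2, hence
  contributes at most 8/m; the harmonic sum supplies the logarithm.\<close>

lemma sum_inverse_ksq_le: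
  assumes "N \<ge> 1"
  shows "(\<Sum>k\<in>square N. 1 / ksq k) \<le> 8 * (1 + ln (real N))"
  using assms
proof (induction N rule: dec_induct)
  case base
  \<comment> \<open>The origin contributes \<open>1 / 0 = 0\<close>, so only the first shell
    counts.\<close>
  have "(\<Sum>k\<in>square (Suc 0). 1 / ksq k) = (\<Sum>k\<in>square (Suc 0) - square 0. 1 / ksq k)"
    by (subst sum_square_Suc) (simp add: square_0)
  also have "\<dots> \<le> 8 * real (Suc 0) * 1"
  proof (rule sum_shell_le)
    fix k assume "k \<in> square (Suc 0) - square 0"
    then have "1 \<le> ksq k" using ksq_shell_ge[of k 0] by simp
    then show "1 / ksq k \<le> 1" by simp
  qed
  finally show ?case by simp
next
  case (step N)
  have "(\<Sum>k\<in>square (Suc N) - square N. 1 / ksq k) \<le> 8 * real (Suc N) * (1 / (real (Suc N))\<^sup>2)"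
  proof (rule sum_shell_le)
    fix k assume "k \<in> square (Suc N) - square N"
    then have "(real (Suc N))\<^sup>2 \<le> ksq k" using ksq_shell_ge[of k N] by simp
    then show "1 / ksq k \<le> 1 / (real (Suc N))\<^sup>2" by (intro frac_le) auto
  qed
  also have "8 * real (Suc N) * (1 / (real (Suc N))\<^sup>2) = 8 * (1 / real (Suc N))"
    by (simp add: power2_eq_square del: of_nat_Suc)
  \<comment> \<open>This is ln t \<le> t - 1 at t = N/(N+1).\<close>
  also have "1 / real (Suc N) \<le> ln (real (Suc N)) - ln (real N)"
  proof -
    have "ln (real N / real (Suc N)) \<le> real N / real (Suc N) - 1"
      using step.hyps by (intro ln_le_minus_one) auto
    also have "\<dots> = - (1 / real (Suc N))" by (simp add: field_simps)
    finally show ?thesis using step.hyps by (simp add: ln_div)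
  qed
  finally show ?case using step.IH by (subst sum_square_Suc) (simp add: algebra_simps)
qed

text \<open>The term \<open>- 1 / real N\<close> is there for the induction, in which the shell
  bounds telescope.\<close>

lemma sum_inverse_ksq_square_le:
  assumes "1 \<le> M" "M \<le> N"
  shows "(\<Sum>k\<in>square N - square M. 1 / (ksq k)\<^sup>2) \<le> 8 * (1 / real M - 1 / real N)"
  using assms(2)
proof (induction N rule: dec_induct)
  case (step N)
  have "(\<Sum>k\<in>square (Suc N) - square N. 1 / (ksq k)\<^sup>2) \<le> 8 * real (Suc N) * (1 / ((real (Suc N))\<^sup>2)\<^sup>2)"
  proof (rule sum_shell_le)
    fix k assume "k \<in> square (Suc N) - square N"
    then have "(real (Suc N))\<^sup>2 \<le> ksq k" using ksq_shell_ge[of k N] by simp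
    then have "((real (Suc N))\<^sup>2)\<^sup>2 \<le> (ksq k)\<^sup>2" by (intro power_mono) auto
    then show "1 / (ksq k)\<^sup>2 \<le> 1 / ((real (Suc N))\<^sup>2)\<^sup>2"
      by (intro frac_le) auto
  qed
  also have "8 * real (Suc N) * (1 / ((real (Suc N))\<^sup>2)\<^sup>2) = 8 * (1 / real (Suc N) ^ 3)"
    by (simp add: power2_eq_square power3_eq_cube del: of_nat_Suc)
  \<comment> \<open>Giving up one power makes the bound telescope. The resulting decay 1/M is what
    becomes the factor \<open>\<Lambda> powr (- 1 / 2)\<close> after taking the root.\<close>
  also have "1 / real (Suc N) ^ 3 \<le> 1 / (real N * real (Suc N))"
  proof (rule divide_left_mono)
    have "real N * real (Suc N) \<le> real (Suc N) ^ 2" by (simp add: power2_eq_square)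
    also have "\<dots> \<le> real (Suc N) ^ 3" by (rule power_increasing) auto
    finally show "real N * real (Suc N) \<le> real (Suc N) ^ 3" .
  qed (use assms(1) step.hyps in auto)
  also have "1 / (real N * real (Suc N)) = 1 / real N - 1 / real (Suc N)"
    using assms(1) step.hyps by (simp add: field_simps)
  finally have *: "(\<Sum>k\<in>square (Suc N) - square N. 1 / (ksq k)\<^sup>2) \<le> 8 * (1 / real N - 1 / real (Suc N))"
    by simp
  have "square (Suc N) - square M = (square N - square M) \<union> (square (Suc N) - square N)"
    using square_mono[of N "Suc N"] square_mono[OF step.hyps(1)] by auto
  then have "(\<Sum>k\<in>square (Suc N) - square M. 1 / (ksq k)\<^sup>2)
      = (\<Sum>k\<in>square N - square M. 1 / (ksq k)\<^sup>2) + (\<Sum>k\<in>square (Suc N) - square N. 1 / (ksq k)\<^sup>2)"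
    by (simp only:) (subst sum.union_disjoint; auto)
  then show ?case using * step.IH by simp
qed simp

lemma summable_inverse_ksq_square: "(\<lambda>k. 1 / (ksq k)\<^sup>2) summable_on UNIV"
proof (rule nonneg_bdd_above_summable_on)
  let ?B = "(\<Sum>k\<in>square 1. 1 / (ksq k)\<^sup>2) + 8"
  have "sum (\<lambda>k. 1 / (ksq k)\<^sup>2) F \<le> ?B" if F: "finite F" for F
  proof -
    obtain N where N: "N \<ge> 1" "F \<subseteq> square N" using finite_subset_square[OF F] by blast
    have "sum (\<lambda>k. 1 / (ksq k)\<^sup>2) F \<le> (\<Sum>k\<in>square N. 1 / (ksq k)\<^sup>2)"
      by (intro sum_mono2 N) auto
    also have "\<dots> = (\<Sum>k\<in>square N - square 1. 1 / (ksq k)\<^sup>2) + (\<Sum>k\<in>square 1. 1 / (ksq k)\<^sup>2)"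
      by (rule sum.subset_diff[OF square_mono[OF N(1)]]) simp
    also have "(\<Sum>k\<in>square N - square 1. 1 / (ksq k)\<^sup>2) \<le> 8 * (1 / real 1 - 1 / real N)"
      by (rule sum_inverse_ksq_square_le[OF _ N(1)]) simp
    also have "\<dots> \<le> 8" by simp
    finally show ?thesis by simp
  qed
  then show "bdd_above (sum (\<lambda>k. 1 / (ksq k)\<^sup>2) ` {F. F \<subseteq> UNIV \<and> finite F})"
    by (intro bdd_aboveI[of _ ?B]) auto
qed auto

text \<open>Cauchy-Schwarz, since 1/|k|^4 is summable over the nonzero points of the planar lattice.
  The hypothesis has the form in which Bessel's inequality delivers it.\<close>

lemma abs_summable_divide_ksq:
  fixes d :: "int \<times> int \<Rightarrow> complex"
  assumes "\<And>A. finite A \<Longrightarrow> (\<Sum>k\<in>A. (norm (d k))\<^sup>2) \<le> B"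
  shows "(\<lambda>k. norm (d k / of_real (ksq k))) summable_on UNIV"
proof -
  have "(\<lambda>k. norm (d k * d k)) summable_on UNIV"
    by (rule nonneg_bdd_above_summable_on)
      (use assms in \<open>auto simp: norm_mult power2_eq_square intro!: bdd_aboveI[of _ B]\<close>)
  moreover have "(\<lambda>k. norm ((1 / of_real (ksq k)) * (1 / of_real (ksq k)) :: complex)) summable_on UNIV"
    using summable_inverse_ksq_square by (simp add: norm_mult norm_divide power2_eq_square)
  ultimately have "(\<lambda>k. norm (d k * (1 / of_real (ksq k)))) summable_on UNIV"
    by (rule abs_summable_product)
  then show ?thesis by simp
qed

section \<open>Square integrable functions and Bessel's inequality for characters\<close>

lemma torus_L2_integrable:
  fixes f :: "real \<times> real \<Rightarrow> 'a::euclidean_space"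
  assumes "torus_L2 f"
  shows "integrable torus f"
proof (rule Bochner_Integration.integrable_bound)
  show "integrable torus (\<lambda>x. 1 + (norm (f x))\<^sup>2)"
    using assms by (simp add: torus_L2_def)
  show "f \<in> borel_measurable torus" using assms by (simp add: torus_L2_def)
  have "t \<le> 1 + t\<^sup>2" for t :: real
    using zero_le_power2[of "t - 1 / 2"] by (simp add: power2_eq_square algebra_simps)
  then show "AE x in torus. norm (f x) \<le> norm (1 + (norm (f x))\<^sup>2)"
    by (intro AE_I2) (simp add: order_trans[OF _ abs_ge_self])
qed

lemma torus_L2_integrable_inner:
  fixes f g :: "real \<times> real \<Rightarrow> 'a::euclidean_space"
  assumes "torus_L2 f" "torus_L2 g"
  shows "integrable torus (\<lambda>x. f x \<bullet> g x)"
proof (rule Bochner_Integration.integrable_bound)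
  show "integrable torus (\<lambda>x. (norm (f x))\<^sup>2 + (norm (g x))\<^sup>2)"
    using assms by (simp add: torus_L2_def)
  show "(\<lambda>x. f x \<bullet> g x) \<in> borel_measurable torus"
    using assms unfolding torus_L2_def by (intro borel_measurable_inner) auto
  have "\<bar>f x \<bullet> g x\<bar> \<le> (norm (f x))\<^sup>2 + (norm (g x))\<^sup>2" for x
  proof -
    have "\<bar>f x \<bullet> g x\<bar> \<le> norm (f x) * norm (g x)" by (rule Cauchy_Schwarz_ineq2)
    also have "\<dots> \<le> (norm (f x))\<^sup>2 + (norm (g x))\<^sup>2"
      using zero_le_power2[of "norm (f x) - norm (g x)"] zero_le_power2[of "norm (f x)"] zero_le_power2[of "norm (g x)"]
      unfolding power2_diff by linarith
    finally show ?thesis .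
  qed
  then show "AE x in torus. norm (f x \<bullet> g x) \<le> norm ((norm (f x))\<^sup>2 + (norm (g x))\<^sup>2)"
    by (intro AE_I2) simp
qed

lemma torus_integral_mult_sum_chr:
  assumes "integrable torus f" "finite A"
  shows "integrable torus (\<lambda>x. f x * (\<Sum>k\<in>A. d k * chr k x))"
    and "(\<integral>x. f x * (\<Sum>k\<in>A. d k * chr k x) \<partial>torus) = (\<Sum>k\<in>A. d k * (\<integral>x. f x * chr k x \<partial>torus))"
proof -
  have *: "integrable torus (\<lambda>x. d k * (f x * chr k x))" for k
    using integrable_mult_chr[OF assms(1)] by simp
  have eq: "(\<lambda>x. f x * (\<Sum>k\<in>A. d k * chr k x)) = (\<lambda>x. \<Sum>k\<in>A. d k * (f x * chr k x))"
    by (simp add: sum_distrib_left mult_ac)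
  show "integrable torus (\<lambda>x. f x * (\<Sum>k\<in>A. d k * chr k x))"
    unfolding eq using * by (intro Bochner_Integration.integrable_sum)
  show "(\<integral>x. f x * (\<Sum>k\<in>A. d k * chr k x) \<partial>torus) = (\<Sum>k\<in>A. d k * (\<integral>x. f x * chr k x \<partial>torus))"
    unfolding eq using * by (subst Bochner_Integration.integral_sum) auto
qed

lemma torus_integral_norm_sum_chr:
  assumes "finite A"
  shows "integrable torus (\<lambda>x. (norm (\<Sum>k\<in>A. d k * chr k x))\<^sup>2)"
    and "(\<integral>x. (norm (\<Sum>k\<in>A. d k * chr k x))\<^sup>2 \<partial>torus) = 4 * pi\<^sup>2 * (\<Sum>k\<in>A. (norm (d k))\<^sup>2)"
proof -
  let ?p = "\<lambda>x. \<Sum>k\<in>A. d k * chr k x"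
  have cont: "continuous_on UNIV ?p" by (intro continuous_intros)
  show "integrable torus (\<lambda>x. (norm (?p x))\<^sup>2)"
    by (intro integrable_torus_continuous continuous_intros)
  have chr: "(\<integral>x. cnj (?p x) * chr k x \<partial>torus) = of_real (4 * pi\<^sup>2) * cnj (d k)" if "k \<in> A" for k
  proof -
    have "(\<integral>x. cnj (?p x) * chr k x \<partial>torus) = (\<integral>x. chr k x * (\<Sum>l\<in>uminus ` A. cnj (d (- l)) * chr l x) \<partial>torus)"
      by (subst sum.reindex) (auto simp: chr_uminus mult.commute intro!: inj_onI)
    also have "\<dots> = (\<Sum>l\<in>uminus ` A. cnj (d (- l)) * (\<integral>x. chr k x * chr l x \<partial>torus))"
      using assms by (intro torus_integral_mult_sum_chr integrable_torus_continuous continuous_intros) auto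
    also have "\<dots> = (\<Sum>l\<in>A. cnj (d l) * (\<integral>x. chr k x * chr (- l) x \<partial>torus))"
      by (subst sum.reindex) (auto intro!: inj_onI)
    also have "\<dots> = (\<Sum>l\<in>A. if l = k then cnj (d k) * of_real (4 * pi\<^sup>2) else 0)"
      by (intro sum.cong) (auto simp: chr_mult torus_integral_chr)
    finally show ?thesis using that assms by simp
  qed
  have "of_real (\<integral>x. (norm (?p x))\<^sup>2 \<partial>torus) = (\<integral>x. complex_of_real ((norm (?p x))\<^sup>2) \<partial>torus)"
    by (rule integral_complex_of_real[symmetric])
  also have "\<dots> = (\<integral>x. cnj (?p x) * ?p x \<partial>torus)"
    by (simp only: complex_norm_square mult.commute)
  also have "\<dots> = (\<Sum>k\<in>A. d k * (\<integral>x. cnj (?p x) * chr k x \<partial>torus))"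
    by (intro torus_integral_mult_sum_chr integrable_torus_continuous continuous_intros assms)
  also have "\<dots> = (\<Sum>k\<in>A. of_real (4 * pi\<^sup>2 * (norm (d k))\<^sup>2))"
    by (intro sum.cong refl, subst chr) (simp_all only: of_real_mult complex_norm_square, simp_all)
  also have "\<dots> = of_real (4 * pi\<^sup>2 * (\<Sum>k\<in>A. (norm (d k))\<^sup>2))"
    by (simp add: sum_distrib_left)
  finally show "(\<integral>x. (norm (?p x))\<^sup>2 \<partial>torus) = 4 * pi\<^sup>2 * (\<Sum>k\<in>A. (norm (d k))\<^sup>2)"
    by (simp only: of_real_eq_iff)
qed

lemma fcoeff_Bessel:
  assumes f: "integrable torus f" "integrable torus (\<lambda>x. (norm (f x))\<^sup>2)" and A: "finite A"
  shows "(\<Sum>k\<in>A. (norm (fcoeff f k))\<^sup>2) \<le> 4 * pi\<^sup>2 * (\<integral>x. (norm (f x))\<^sup>2 \<partial>torus)"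
proof -
  define c where "c = fcoeff f"
  define s where "s = (\<Sum>k\<in>A. (norm (c k))\<^sup>2)"
  define p where "p x = (\<Sum>k\<in>A. c k * chr k x)" for x
  \<comment> \<open>With unnormalised coefficients, \<open>t\<close> is the factor that makes
    \<open>t * p\<close> the orthogonal projection of \<open>f\<close> onto the span of the
    characters from \<open>A\<close>.\<close>
  define t where "t = 1 / (4 * pi\<^sup>2)"
  have cnjp: "cnj (p x) = (\<Sum>k\<in>uminus ` A. cnj (c (- k)) * chr k x)" for x
    unfolding p_def by (subst sum.reindex) (auto simp: chr_uminus intro!: inj_onI)
  have i1: "integrable torus (\<lambda>x. f x * cnj (p x))"
    unfolding cnjp using A by (intro torus_integral_mult_sum_chr f) auto
  have "(\<integral>x. f x * cnj (p x) \<partial>torus) = (\<Sum>k\<in>uminus ` A. cnj (c (- k)) * (\<integral>x. f x * chr k x \<partial>torus))"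
    unfolding cnjp using A by (intro torus_integral_mult_sum_chr f) auto
  also have "\<dots> = (\<Sum>k\<in>A. cnj (c k) * c k)"
    by (subst sum.reindex) (auto simp: c_def fcoeff_def intro!: inj_onI)
  also have "\<dots> = of_real s"
    unfolding s_def of_real_sum complex_norm_square by (simp add: mult.commute)
  finally have e1: "(\<integral>x. Re (f x * cnj (p x)) \<partial>torus) = s"
    using integral_Re[OF i1] by simp
  have i2: "integrable torus (\<lambda>x. (norm (p x))\<^sup>2)" and e2: "(\<integral>x. (norm (p x))\<^sup>2 \<partial>torus) = 4 * pi\<^sup>2 * s"
    unfolding p_def s_def by (rule torus_integral_norm_sum_chr[OF A])+
  have sq: "(norm (z - of_real t * w))\<^sup>2 = (norm z)\<^sup>2 - 2 * t * Re (z * cnj w) + t\<^sup>2 * (norm w)\<^sup>2" for z w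
    by (simp add: cmod_power2) (simp add: power2_eq_square algebra_simps)
  have "0 \<le> (\<integral>x. (norm (f x - of_real t * p x))\<^sup>2 \<partial>torus)" by simp
  also have "\<dots> = (\<integral>x. (norm (f x))\<^sup>2 \<partial>torus) - 2 * t * (\<integral>x. Re (f x * cnj (p x)) \<partial>torus)
      + t\<^sup>2 * (\<integral>x. (norm (p x))\<^sup>2 \<partial>torus)"
    unfolding sq using f(2) i1 i2 integrable_Re[OF i1] by (simp del: times_complex.sel)
  also have "\<dots> = (\<integral>x. (norm (f x))\<^sup>2 \<partial>torus) - t * s"
    unfolding e1 e2 by (simp add: t_def power2_eq_square)
  finally have "t * s \<le> (\<integral>x. (norm (f x))\<^sup>2 \<partial>torus)" by simp
  then show ?thesis unfolding s_def[symmetric] c_def[symmetric] t_def by (simp add: field_simps)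
qed

section \<open>Absolutely convergent Fourier series\<close>

definition series :: "(int \<times> int \<Rightarrow> complex) \<Rightarrow> real \<times> real \<Rightarrow> complex" where
  "series a x = (\<Sum>\<^sub>\<infinity>k. a k * chr k x)"

context
  fixes a :: "int \<times> int \<Rightarrow> complex"
  assumes a: "(\<lambda>k. norm (a k)) summable_on UNIV"
begin

lemma series_tendsto: "(\<lambda>N. \<Sum>k\<in>square N. a k * chr k x) \<longlonglongrightarrow> series a x"
proof -
  have "(\<lambda>k. norm (a k * chr k x)) summable_on UNIV"
    using a by (simp add: norm_mult)
  from has_sum_infsum[OF Infinite_Sum.abs_summable_summable[OF this]]
  have "(sum (\<lambda>k. a k * chr k x) \<longlongrightarrow> series a x) (finite_subsets_at_top UNIV)"
    by (simp add: series_def has_sum_def)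
  from filterlim_compose[OF this filterlim_square] show ?thesis .
qed

lemma norm_sum_chr_le: "norm (\<Sum>k\<in>square N. a k * chr k x) \<le> (\<Sum>\<^sub>\<infinity>k. norm (a k))"
proof -
  have "norm (\<Sum>k\<in>square N. a k * chr k x) \<le> (\<Sum>k\<in>square N. norm (a k))"
    by (rule order_trans[OF norm_sum]) (simp add: norm_mult)
  also have "\<dots> \<le> (\<Sum>\<^sub>\<infinity>k. norm (a k))"
    by (rule finite_sum_le_infsum[OF a]) auto
  finally show ?thesis .
qed

lemma norm_series_le: "norm (series a x) \<le> (\<Sum>\<^sub>\<infinity>k. norm (a k))"
  by (rule LIMSEQ_le_const2[OF tendsto_norm[OF series_tendsto]]) (use norm_sum_chr_le in blast)

lemma series_measurable: "series a \<in> borel_measurable torus"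
  by (rule borel_measurable_LIMSEQ_metric[OF borel_measurable_torus_continuous series_tendsto])
    (intro continuous_intros)

text \<open>Dominated convergence: the partial sums are bounded uniformly by the sum of the
  \<open>norm (a k)\<close>, so integrability of \<open>f\<close> suffices for a majorant.\<close>

lemma integral_mult_series:
  assumes f: "integrable torus f"
  shows "integrable torus (\<lambda>x. f x * series a x)"
    and "(\<lambda>N. \<Sum>k\<in>square N. a k * (\<integral>x. f x * chr k x \<partial>torus)) \<longlonglongrightarrow> (\<integral>x. f x * series a x \<partial>torus)"
proof -
  let ?S = "\<Sum>\<^sub>\<infinity>k. norm (a k)"
  have S: "?S \<ge> 0" by (rule infsum_nonneg) simp
  have dom: "integrable torus (\<lambda>x. norm (f x) * ?S)" using f by simp
  have [measurable]: "f \<in> borel_measurable torus" "series a \<in> borel_measurable torus"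
    using f series_measurable by auto
  have lim: "AE x in torus. (\<lambda>N. f x * (\<Sum>k\<in>square N. a k * chr k x)) \<longlonglongrightarrow> f x * series a x"
    by (intro AE_I2 tendsto_intros series_tendsto)
  have bd: "AE x in torus. norm (f x * (\<Sum>k\<in>square N. a k * chr k x)) \<le> norm (f x) * ?S" for N
    unfolding norm_mult by (intro AE_I2 mult_left_mono norm_sum_chr_le) auto
  have m: "(\<lambda>x. f x * (\<Sum>k\<in>square N. a k * chr k x)) \<in> borel_measurable torus" for N
    using torus_integral_mult_sum_chr(1)[OF f finite_square] by (rule borel_measurable_integrable)
  have m2: "(\<lambda>x. f x * series a x) \<in> borel_measurable torus" by measurable
  show "integrable torus (\<lambda>x. f x * series a x)"
    by (rule integrable_dominated_convergence[OF m2 m dom lim bd])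
  show "(\<lambda>N. \<Sum>k\<in>square N. a k * (\<integral>x. f x * chr k x \<partial>torus)) \<longlonglongrightarrow> (\<integral>x. f x * series a x \<partial>torus)"
    using integral_dominated_convergence[OF m2 m dom lim bd]
    by (simp only: torus_integral_mult_sum_chr(2)[OF f finite_square])
qed

lemma integrable_series: "integrable torus (series a)"
  using integral_mult_series(1)[of "\<lambda>_. 1"] by simp

text \<open>Integrating against \<open>chr (- k)\<close> termwise, the partial sums become
  stationary as soon as the square contains \<open>k\<close>.\<close>

lemma fcoeff_series: "fcoeff (series a) k = of_real (4 * pi\<^sup>2) * a k"
proof -
  have lim: "(\<lambda>N. \<Sum>l\<in>square N. a l * (\<integral>x. chr (- k) x * chr l x \<partial>torus)) \<longlonglongrightarrow> fcoeff (series a) k"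
    unfolding fcoeff_def mult.commute[of "series a _"]
    by (intro integral_mult_series integrable_torus_continuous continuous_intros)
  have ev: "eventually (\<lambda>N. (\<Sum>l\<in>square N. a l * (\<integral>x. chr (- k) x * chr l x \<partial>torus))
      = of_real (4 * pi\<^sup>2) * a k) sequentially"
  proof -
    obtain M where M: "{k} \<subseteq> square M" using finite_subset_square[of "{k}"] by auto
    have "(\<Sum>l\<in>square N. a l * (\<integral>x. chr (- k) x * chr l x \<partial>torus)) = of_real (4 * pi\<^sup>2) * a k"
      if "N \<ge> M" for N
    proof -
      have k: "k \<in> square N" using M square_mono[OF that] by auto
      have "(\<Sum>l\<in>square N. a l * (\<integral>x. chr (- k) x * chr l x \<partial>torus))
          = (\<Sum>l\<in>square N. if l = k then a k * of_real (4 * pi\<^sup>2) else 0)"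
        by (intro sum.cong) (auto simp: chr_mult torus_integral_chr)
      then show ?thesis using k by simp
    qed
    then show ?thesis by (rule eventually_sequentiallyI)
  qed
  show ?thesis
    by (rule LIMSEQ_unique[OF lim tendsto_eventually[OF ev]])
qed

text \<open>The bridge from weak objects to pointwise values: the difference is integrable with
  vanishing coefficients, and uniqueness applies.\<close>

lemma AE_eq_series:
  assumes f: "integrable torus f" "\<And>k. fcoeff f k = of_real (4 * pi\<^sup>2) * a k"
  shows "AE x in torus. f x = series a x"
proof -
  have "AE x in torus. f x - series a x = 0"
  proof (rule fcoeff_eq_0_imp_AE_eq_0)
    show "integrable torus (\<lambda>x. f x - series a x)"
      using f(1) integrable_series by simp
    fix k
    have "fcoeff (\<lambda>x. f x - series a x) k = fcoeff f k - fcoeff (series a) k"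
      unfolding fcoeff_def left_diff_distrib
      by (intro Bochner_Integration.integral_diff integrable_mult_chr f integrable_series)
    then show "fcoeff (\<lambda>x. f x - series a x) k = 0"
      using f(2) fcoeff_series by simp
  qed
  then show ?thesis by simp
qed

end

section \<open>Weak derivatives and the inverse Laplacian in Fourier coefficients\<close>

lemma torus_testD:
  assumes "torus_test \<eta>"
  shows torus_test_has_derivative: "(\<eta> has_derivative (\<lambda>u. dir_deriv u \<eta> x)) (at x)"
    and torus_test_continuous: "continuous_on S \<eta>"
    and torus_test_periodic: "\<eta> (x + (2 * pi, 0)) = \<eta> x" "\<eta> (x + (0, 2 * pi)) = \<eta> x"
proof -
  have "foldr dir_deriv [] \<eta> differentiable at x" for x
    using assms unfolding torus_test_def by blast
  then have d: "(\<eta> has_derivative (\<lambda>u. dir_deriv u \<eta> x)) (at x)" for x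
    unfolding dir_deriv_def by (simp add: frechet_derivative_works)
  then show "(\<eta> has_derivative (\<lambda>u. dir_deriv u \<eta> x)) (at x)" .
  show "continuous_on S \<eta>"
    by (rule has_derivative_continuous_on, rule has_derivative_at_withinI, rule d)
  show "\<eta> (x + (2 * pi, 0)) = \<eta> x" "\<eta> (x + (0, 2 * pi)) = \<eta> x"
    using assms unfolding torus_test_def by blast+
qed

lemma dir_deriv_eqI:
  assumes "(f has_derivative D) (at x)"
  shows "dir_deriv u f x = D u"
  using frechet_derivative_at[OF assms] by (simp add: dir_deriv_def)

lemma torus_test_dir_deriv:
  assumes "torus_test \<eta>"
  shows "torus_test (dir_deriv u \<eta>)"
  unfolding torus_test_def
proof (intro conjI allI)
  fix us x
  have "foldr dir_deriv (us @ [u]) \<eta> differentiable at x"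
    using assms unfolding torus_test_def by blast
  then show "foldr dir_deriv us (dir_deriv u \<eta>) differentiable at x" by simp
next
  have per: "dir_deriv u \<eta> (x + p) = dir_deriv u \<eta> x" if p: "\<And>x. \<eta> (x + p) = \<eta> x" for x p
  proof -
    have "((\<lambda>y. \<eta> (y + p)) has_derivative (\<lambda>u. dir_deriv u \<eta> (x + p))) (at x)"
      by (rule has_derivative_compose[OF _ torus_test_has_derivative[OF assms]])
        (auto intro!: derivative_eq_intros)
    then show ?thesis unfolding p by (simp add: dir_deriv_eqI)
  qed
  fix x
  show "dir_deriv u \<eta> (x + (2 * pi, 0)) = dir_deriv u \<eta> x"
    "dir_deriv u \<eta> (x + (0, 2 * pi)) = dir_deriv u \<eta> x"
    by (rule per torus_test_periodic[OF assms])+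
qed

lemma has_derivative_Re_chr:
  "((\<lambda>x. Re (c * chr k x)) has_derivative (\<lambda>u. Re (c * (\<i> * of_real (kdot k u)) * chr k x))) (at x)"
  using has_derivative_Re[OF has_derivative_mult_right[OF has_derivative_chr[of k x], of c]]
  by (simp add: mult_ac)

lemma dir_deriv_Re_chr:
  "dir_deriv u (\<lambda>x. Re (c * chr k x)) = (\<lambda>x. Re (c * (\<i> * of_real (kdot k u)) * chr k x))"
  by (rule ext, rule dir_deriv_eqI[OF has_derivative_Re_chr])

text \<open>Directional derivatives only change the constant, so the family is closed under them. A
  complex \<open>c\<close> covers sine and cosine at once.\<close>

lemma torus_test_Re_chr: "torus_test (\<lambda>x. Re (c * chr k x))"
  unfolding torus_test_def
proof (intro conjI allI)
  fix us x
  have "\<exists>d. foldr dir_deriv us (\<lambda>x. Re (c * chr k x)) = (\<lambda>x. Re (d * chr k x))"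
  proof (induction us)
    case (Cons u us)
    then obtain d where "foldr dir_deriv us (\<lambda>x. Re (c * chr k x)) = (\<lambda>x. Re (d * chr k x))" by blast
    then have "foldr dir_deriv (u # us) (\<lambda>x. Re (c * chr k x)) = dir_deriv u (\<lambda>x. Re (d * chr k x))"
      by simp
    then show ?case unfolding dir_deriv_Re_chr by blast
  qed auto
  then show "foldr dir_deriv us (\<lambda>x. Re (c * chr k x)) differentiable at x"
    using has_derivative_Re_chr by (metis differentiable_def)
qed (simp_all only: chr_periodic)

section \<open>Fourier coefficients of real functions under weak and classical derivatives\<close>

definition rcoeff :: "(real \<times> real \<Rightarrow> real) \<Rightarrow> int \<times> int \<Rightarrow> complex" where
  "rcoeff f = fcoeff (\<lambda>x. of_real (f x))"

lemma rcoeff_uminus: "rcoeff f (- k) = cnj (rcoeff f k)"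
  unfolding rcoeff_def fcoeff_def by (subst Bochner_Integration.integral_cnj[symmetric]) (simp add: chr_uminus)

lemma rcoeff_0: "rcoeff f 0 = of_real (\<integral>x. f x \<partial>torus)"
  by (simp add: rcoeff_def fcoeff_def)

lemma torus_inner_Re_chr:
  assumes "integrable torus f"
  shows "torus_inner f (\<lambda>x. Re (c * chr k x)) = Re (c * rcoeff f (- k))"
proof -
  have i: "integrable torus (\<lambda>x. of_real (f x) * chr k x)"
    using assms by (intro integrable_mult_chr) simp
  have "c * rcoeff f (- k) = (\<integral>x. c * (of_real (f x) * chr k x) \<partial>torus)"
    by (simp add: rcoeff_def fcoeff_def)
  also have "Re \<dots> = (\<integral>x. Re (c * (of_real (f x) * chr k x)) \<partial>torus)"
    using i by (intro integral_Re[symmetric]) simp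
  also have "\<dots> = torus_inner f (\<lambda>x. Re (c * chr k x))"
    unfolding torus_inner_def by (intro Bochner_Integration.integral_cong) (auto simp: algebra_simps)
  finally show ?thesis ..
qed

text \<open>Test functions are real; varying the complex factor \<open>c\<close> in
  \<open>Re (c * chr k x)\<close> recovers complex identities from them.\<close>

lemma complex_eq_Re_mult:
  assumes "\<And>c. Re (c * z) = Re (c * w)"
  shows "z = w"
  using assms[of 1] assms[of \<i>] by (simp add: complex_eq_iff)

lemma sum_Basis_kdot_square: "(\<Sum>u\<in>Basis. (kdot k u)\<^sup>2) = ksq k"
  by (simp add: Basis_real_prod kdot_def ksq_def)

text \<open>The weak identity is tested with \<open>Re (c * chr (- k) x)\<close>; the minus sign of
  integration by parts and that of the frequency cancel.\<close>

lemma rcoeff_weak_grad: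
  assumes f: "integrable torus f" and g: "weak_grad f g" and u: "u \<in> Basis"
  shows "rcoeff (\<lambda>x. g x \<bullet> u) k = \<i> * of_real (kdot k u) * rcoeff f k"
proof (rule complex_eq_Re_mult)
  fix c
  have gu: "integrable torus (\<lambda>x. g x \<bullet> u)"
    using g by (auto simp: weak_grad_def dest: torus_L2_integrable)
  have "torus_inner f (dir_deriv u (\<lambda>x. Re (c * chr (- k) x)))
      = - torus_inner (\<lambda>x. g x \<bullet> u) (\<lambda>x. Re (c * chr (- k) x))"
    using g u torus_test_Re_chr unfolding weak_grad_def by blast
  then have "Re (c * (\<i> * of_real (kdot (- k) u)) * rcoeff f k) = - Re (c * rcoeff (\<lambda>x. g x \<bullet> u) k)"
    unfolding dir_deriv_Re_chr torus_inner_Re_chr[OF f] torus_inner_Re_chr[OF gu] by simp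
  then show "Re (c * rcoeff (\<lambda>x. g x \<bullet> u) k) = Re (c * (\<i> * of_real (kdot k u) * rcoeff f k))"
    by (simp add: kdot_simps mult.assoc)
qed

lemma rcoeff_weak_laplacian:
  assumes f: "integrable torus f" and h: "weak_laplacian f h"
  shows "rcoeff h k = - of_real (ksq k) * rcoeff f k"
proof (rule complex_eq_Re_mult)
  fix c
  have hi: "integrable torus h"
    using h by (auto simp: weak_laplacian_def dest: torus_L2_integrable)
  have "(\<lambda>x. \<Sum>u\<in>Basis. dir_deriv u (dir_deriv u (\<lambda>x. Re (c * chr (- k) x))) x)
      = (\<lambda>x. \<Sum>u\<in>Basis. Re (c * (\<i> * of_real (kdot (- k) u)) * (\<i> * of_real (kdot (- k) u)) * chr (- k) x))"
    by (simp only: dir_deriv_Re_chr)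
  also have "\<dots> = (\<lambda>x. \<Sum>u\<in>Basis. - (kdot k u)\<^sup>2 * Re (c * chr (- k) x))"
    by (intro ext sum.cong refl) (simp add: kdot_simps power2_eq_square algebra_simps)
  also have "\<dots> = (\<lambda>x. Re (c * (- of_real (ksq k)) * chr (- k) x))"
    unfolding sum_distrib_right[symmetric] sum_negf sum_Basis_kdot_square
    by (simp add: algebra_simps)
  finally have lap: "(\<lambda>x. \<Sum>u\<in>Basis. dir_deriv u (dir_deriv u (\<lambda>x. Re (c * chr (- k) x))) x)
    = (\<lambda>x. Re (c * (- of_real (ksq k)) * chr (- k) x))" .
  have "torus_inner f (\<lambda>x. \<Sum>u\<in>Basis. dir_deriv u (dir_deriv u (\<lambda>x. Re (c * chr (- k) x))) x)
      = torus_inner h (\<lambda>x. Re (c * chr (- k) x))"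
    using h torus_test_Re_chr unfolding weak_laplacian_def by blast
  then show "Re (c * rcoeff h k) = Re (c * (- of_real (ksq k) * rcoeff f k))"
    unfolding lap torus_inner_Re_chr[OF f] torus_inner_Re_chr[OF hi] by (simp add: mult.assoc)
qed

lemma integrable_torus_test: "torus_test \<eta> \<Longrightarrow> integrable torus \<eta>"
  by (intro integrable_torus_continuous torus_test_continuous)

text \<open>Classical integration by parts: the derivative of the periodic product of
  \<open>\<eta>\<close> with a character integrates to 0.\<close>

lemma rcoeff_dir_deriv:
  assumes \<eta>: "torus_test \<eta>" and u: "u \<in> Basis"
  shows "rcoeff (dir_deriv u \<eta>) k = \<i> * of_real (kdot k u) * rcoeff \<eta> k"
proof -
  let ?D = "\<lambda>x h. of_real (\<eta> x) * (\<i> * of_real (kdot (- k) h) * chr (- k) x) + of_real (dir_deriv h \<eta> x) * chr (- k) x"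
  have i: "integrable torus (\<lambda>x. of_real (\<eta> x) * chr (- k) x)"
    using integrable_torus_test[OF \<eta>] by (intro integrable_mult_chr) simp
  have i': "integrable torus (\<lambda>x. of_real (dir_deriv u \<eta> x) * chr (- k) x)"
    using integrable_torus_test[OF torus_test_dir_deriv[OF \<eta>]] by (intro integrable_mult_chr) simp
  have "(\<integral>x. ?D x u \<partial>torus) = 0"
  proof (rule torus_integral_derivative[OF _ _ _ _ u])
    show "((\<lambda>x. of_real (\<eta> x) * chr (- k) x) has_derivative ?D x) (at x)" for x
      by (intro has_derivative_mult has_derivative_of_real has_derivative_chr torus_test_has_derivative[OF \<eta>])
    show "continuous_on UNIV (\<lambda>x. ?D x u)"
      by (intro continuous_intros torus_test_continuous[OF \<eta>] torus_test_continuous[OF torus_test_dir_deriv[OF \<eta>]])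
  qed (simp_all only: chr_periodic torus_test_periodic[OF \<eta>])
  also have "(\<integral>x. ?D x u \<partial>torus) = (\<integral>x. (\<i> * of_real (kdot (- k) u)) * (of_real (\<eta> x) * chr (- k) x)
      + of_real (dir_deriv u \<eta> x) * chr (- k) x \<partial>torus)"
    by (intro Bochner_Integration.integral_cong) (simp_all add: algebra_simps)
  also have "\<dots> = (\<integral>x. (\<i> * of_real (kdot (- k) u)) * (of_real (\<eta> x) * chr (- k) x) \<partial>torus)
      + (\<integral>x. of_real (dir_deriv u \<eta> x) * chr (- k) x \<partial>torus)"
    by (intro Bochner_Integration.integral_add integrable_mult_right i i')
  finally show ?thesis
    using i by (simp add: rcoeff_def fcoeff_def kdot_simps add_eq_0_iff2)
qed

lemma rcoeff_dir_deriv_twice: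
  assumes \<eta>: "torus_test \<eta>" and u: "u \<in> Basis"
  shows "rcoeff (dir_deriv u (dir_deriv u \<eta>)) k = - of_real ((kdot k u)\<^sup>2) * rcoeff \<eta> k"
  unfolding rcoeff_dir_deriv[OF torus_test_dir_deriv[OF \<eta>] u] rcoeff_dir_deriv[OF \<eta> u]
  by (simp add: power2_eq_square algebra_simps)

definition laplacian :: "(real \<times> real \<Rightarrow> real) \<Rightarrow> real \<times> real \<Rightarrow> real" where
  "laplacian \<eta> = (\<lambda>x. \<Sum>u\<in>Basis. dir_deriv u (dir_deriv u \<eta>) x)"

lemma laplacian_test:
  assumes \<eta>: "torus_test \<eta>"
  shows "continuous_on S (laplacian \<eta>)"
    and "rcoeff (laplacian \<eta>) k = - of_real (ksq k) * rcoeff \<eta> k"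
proof -
  note t = torus_test_dir_deriv[OF \<eta>]
  show "continuous_on S (laplacian \<eta>)"
    unfolding laplacian_def by (intro continuous_on_sum torus_test_continuous torus_test_dir_deriv \<eta>)
  have "rcoeff (laplacian \<eta>) k = (\<Sum>u\<in>Basis. rcoeff (dir_deriv u (dir_deriv u \<eta>)) k)"
    unfolding laplacian_def rcoeff_def fcoeff_def of_real_sum sum_distrib_right
    using integrable_torus_test[OF torus_test_dir_deriv[OF t]]
    by (intro Bochner_Integration.integral_sum integrable_mult_chr) simp
  also have "\<dots> = (\<Sum>u\<in>Basis. - of_real ((kdot k u)\<^sup>2) * rcoeff \<eta> k)"
    by (intro sum.cong refl) (simp add: rcoeff_dir_deriv_twice[OF \<eta>])
  also have "\<dots> = - of_real (ksq k) * rcoeff \<eta> k"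
    unfolding sum_distrib_right[symmetric] sum_negf of_real_sum[symmetric] sum_Basis_kdot_square ..
  finally show "rcoeff (laplacian \<eta>) k = - of_real (ksq k) * rcoeff \<eta> k" .
qed

section \<open>Expansion of test functions and the way back to weak identities\<close>

lemma rcoeff_Bessel:
  assumes f: "torus_L2 f" and A: "finite A"
  shows "(\<Sum>k\<in>A. (norm (rcoeff f k))\<^sup>2) \<le> 4 * pi\<^sup>2 * (\<integral>x. (f x)\<^sup>2 \<partial>torus)"
  using fcoeff_Bessel[of "\<lambda>x. of_real (f x)" A] torus_L2_integrable[OF f] f A
  by (simp add: rcoeff_def torus_L2_def)

lemma torus_L2_bounded:
  fixes f :: "real \<times> real \<Rightarrow> 'a::euclidean_space"
  assumes "f \<in> borel_measurable torus" "\<And>x. norm (f x) \<le> B"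
  shows "torus_L2 f"
  unfolding torus_L2_def
proof
  show "integrable torus (\<lambda>x. (norm (f x))\<^sup>2)"
  proof (rule torus.integrable_const_bound[where B = "B\<^sup>2"])
    show "AE x in torus. norm ((norm (f x))\<^sup>2) \<le> B\<^sup>2"
      using assms(2) by (intro AE_I2) (simp add: power_mono)
    show "(\<lambda>x. (norm (f x))\<^sup>2) \<in> borel_measurable torus"
      using assms(1) by measurable
  qed
qed (rule assms)

lemma torus_L2_continuous:
  fixes f :: "real \<times> real \<Rightarrow> 'a::euclidean_space"
  assumes "continuous_on UNIV f"
  shows "torus_L2 f"
  unfolding torus_L2_def
  by (intro conjI borel_measurable_torus_continuous integrable_torus_continuous continuous_intros assms)

lemma torus_L2_inner_Basis:
  fixes g :: "real \<times> real \<Rightarrow> 'a::euclidean_space"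
  assumes g: "torus_L2 g" and u: "u \<in> Basis"
  shows "torus_L2 (\<lambda>x. g x \<bullet> u)"
proof -
  have m: "(\<lambda>x. g x \<bullet> u) \<in> borel_measurable torus"
    using g by (auto simp: torus_L2_def)
  have "integrable torus (\<lambda>x. (norm (g x \<bullet> u))\<^sup>2)"
  proof (rule Bochner_Integration.integrable_bound)
    show "integrable torus (\<lambda>x. (norm (g x))\<^sup>2)" using g by (simp add: torus_L2_def)
    show "AE x in torus. norm ((norm (g x \<bullet> u))\<^sup>2) \<le> norm ((norm (g x))\<^sup>2)"
      using Basis_le_norm[OF u] by (intro AE_I2) (simp add: abs_le_square_iff[symmetric])
  qed (use m in measurable)
  then show ?thesis using m by (simp add: torus_L2_def)
qed

text \<open>Bessel's inequality for \<open>laplacian \<eta>\<close> makes |k|^2 times the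
  coefficients square summable, and dividing by |k|^2 gives absolute summability.\<close>

lemma torus_test_coeff_summable:
  assumes \<eta>: "torus_test \<eta>"
  shows "(\<lambda>k. norm (rcoeff \<eta> k / of_real (4 * pi\<^sup>2))) summable_on UNIV"
proof -
  have "(\<lambda>k. norm (rcoeff (laplacian \<eta>) k / of_real (ksq k))) summable_on UNIV"
    by (rule abs_summable_divide_ksq[OF rcoeff_Bessel])
      (intro torus_L2_continuous laplacian_test \<eta>)
  \<comment> \<open>The coefficient at 0 is invisible to the Laplacian and is restored
    separately.\<close>
  moreover have "(\<lambda>k. if k = 0 then norm (rcoeff \<eta> 0) else 0) summable_on UNIV"
    by (rule finite_nonzero_values_imp_summable_on) (auto intro: finite_subset[of _ "{0}"])
  ultimately have "(\<lambda>k. norm (rcoeff (laplacian \<eta>) k / of_real (ksq k))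
      + (if k = 0 then norm (rcoeff \<eta> 0) else 0)) summable_on UNIV"
    by (rule summable_on_add)
  also have "(\<lambda>k. norm (rcoeff (laplacian \<eta>) k / of_real (ksq k))
      + (if k = 0 then norm (rcoeff \<eta> 0) else 0)) = (\<lambda>k. norm (rcoeff \<eta> k))"
    by (auto simp: laplacian_test(2)[OF \<eta>] fun_eq_iff norm_mult norm_divide)
  finally have "(\<lambda>k. norm (rcoeff \<eta> k) * (1 / (4 * pi\<^sup>2))) summable_on UNIV"
    by (rule summable_on_cmult_left)
  then show ?thesis by (simp add: norm_divide norm_mult norm_power)
qed

text \<open>The series of \<open>\<eta>\<close> converges absolutely, so it may be integrated
  termwise against a merely integrable \<open>f\<close>. The pairing is bilinear, hence the
  frequency \<open>- k\<close> instead of a conjugate.\<close>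

lemma torus_test_Parseval:
  assumes f: "integrable torus f" and \<eta>: "torus_test \<eta>"
  shows "(\<lambda>N. \<Sum>k\<in>square N. rcoeff \<eta> k / of_real (4 * pi\<^sup>2) * rcoeff f (- k)) \<longlonglongrightarrow> of_real (torus_inner f \<eta>)"
proof -
  note s = torus_test_coeff_summable[OF \<eta>]
  let ?S = "series (\<lambda>k. rcoeff \<eta> k / of_real (4 * pi\<^sup>2))"
  have f': "integrable torus (\<lambda>x. complex_of_real (f x))" using f by simp
  have AE: "AE x in torus. of_real (\<eta> x) = ?S x"
    using integrable_torus_test[OF \<eta>] by (intro AE_eq_series[OF s]) (simp_all add: rcoeff_def)
  have "of_real (torus_inner f \<eta>) = (\<integral>x. complex_of_real (f x) * of_real (\<eta> x) \<partial>torus)"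
    by (simp only: torus_inner_def inner_real_def flip: integral_complex_of_real of_real_mult)
  also have "\<dots> = (\<integral>x. of_real (f x) * ?S x \<partial>torus)"
  proof (rule integral_cong_AE)
    show "AE x in torus. of_real (f x) * of_real (\<eta> x) = of_real (f x) * ?S x"
      using AE by eventually_elim simp
    show "(\<lambda>x. complex_of_real (f x) * of_real (\<eta> x)) \<in> borel_measurable torus"
      using f integrable_torus_test[OF \<eta>] by simp
    show "(\<lambda>x. complex_of_real (f x) * ?S x) \<in> borel_measurable torus"
      using integral_mult_series(1)[OF s f'] by simp
  qed
  finally show ?thesis
    using integral_mult_series(2)[OF s f'] by (simp add: rcoeff_def fcoeff_def)
qed

text \<open>Converse to \<open>rcoeff_weak_grad\<close>: both sides of the weak identity are limits
  of Parseval sums that agree term by term.\<close>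

lemma weak_gradI:
  assumes f: "integrable torus f" and g: "torus_L2 g"
    and coeff: "\<And>u k. u \<in> Basis \<Longrightarrow> rcoeff (\<lambda>x. g x \<bullet> u) k = \<i> * of_real (kdot k u) * rcoeff f k"
  shows "weak_grad f g"
  unfolding weak_grad_def
proof (intro conjI allI impI ballI)
  fix \<eta> and u :: "real \<times> real" assume \<eta>: "torus_test \<eta>" and u: "u \<in> Basis"
  have gu: "integrable torus (\<lambda>x. g x \<bullet> u)" using torus_L2_integrable[OF g] by simp
  have "(\<lambda>N. - (\<Sum>k\<in>square N. rcoeff (dir_deriv u \<eta>) k / of_real (4 * pi\<^sup>2) * rcoeff f (- k)))
      \<longlonglongrightarrow> - of_real (torus_inner f (dir_deriv u \<eta>))"
    by (intro tendsto_minus torus_test_Parseval f torus_test_dir_deriv \<eta>)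
  also have "(\<lambda>N. - (\<Sum>k\<in>square N. rcoeff (dir_deriv u \<eta>) k / of_real (4 * pi\<^sup>2) * rcoeff f (- k)))
      = (\<lambda>N. \<Sum>k\<in>square N. rcoeff \<eta> k / of_real (4 * pi\<^sup>2) * rcoeff (\<lambda>x. g x \<bullet> u) (- k))"
    unfolding coeff[OF u] rcoeff_dir_deriv[OF \<eta> u] sum_negf[symmetric]
    by (intro ext sum.cong refl) (simp add: kdot_simps mult_ac)
  finally have "- complex_of_real (torus_inner f (dir_deriv u \<eta>)) = of_real (torus_inner (\<lambda>x. g x \<bullet> u) \<eta>)"
    using LIMSEQ_unique torus_test_Parseval[OF gu \<eta>] by blast
  then show "torus_inner f (dir_deriv u \<eta>) = - torus_inner (\<lambda>x. g x \<bullet> u) \<eta>"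
    by (metis minus_equation_iff of_real_eq_iff of_real_minus)
qed (rule g)

lemma weak_laplacianI:
  assumes f: "torus_L2 f" and h: "torus_L2 h"
    and coeff: "\<And>k. rcoeff h k = - of_real (ksq k) * rcoeff f k"
  shows "weak_laplacian f h"
  unfolding weak_laplacian_def laplacian_def[symmetric]
proof (intro conjI allI impI)
  fix \<eta> assume \<eta>: "torus_test \<eta>"
  have lap: "laplacian \<eta> = (\<lambda>x. \<Sum>u\<in>Basis. dir_deriv u (dir_deriv u \<eta>) x)"
    by (rule laplacian_def)
  have "complex_of_real (torus_inner f (laplacian \<eta>))
      = (\<Sum>u\<in>Basis. of_real (torus_inner f (dir_deriv u (dir_deriv u \<eta>))))"
  proof -
    have "torus_inner f (laplacian \<eta>) = (\<Sum>u\<in>Basis. torus_inner f (dir_deriv u (dir_deriv u \<eta>)))"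
      unfolding torus_inner_def lap inner_sum_right
      by (intro Bochner_Integration.integral_sum torus_L2_integrable_inner f torus_L2_continuous
          torus_test_continuous torus_test_dir_deriv \<eta>)
    then show ?thesis by simp
  qed
  \<comment> \<open>Parseval is applied to each second derivative, which is again a test function;
    summing the factors over the two directions then yields \<open>ksq k\<close>.\<close>
  moreover have "(\<lambda>N. \<Sum>u\<in>Basis. \<Sum>k\<in>square N. rcoeff (dir_deriv u (dir_deriv u \<eta>)) k / of_real (4 * pi\<^sup>2) * rcoeff f (- k))
      \<longlonglongrightarrow> (\<Sum>u\<in>Basis. of_real (torus_inner f (dir_deriv u (dir_deriv u \<eta>))))"
    by (intro tendsto_sum torus_test_Parseval torus_L2_integrable f torus_test_dir_deriv \<eta>)
  moreover have "(\<lambda>N. \<Sum>u\<in>Basis. \<Sum>k\<in>square N. rcoeff (dir_deriv u (dir_deriv u \<eta>)) k / of_real (4 * pi\<^sup>2) * rcoeff f (- k))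
      = (\<lambda>N. \<Sum>k\<in>square N. rcoeff \<eta> k / of_real (4 * pi\<^sup>2) * rcoeff h (- k))"
  proof
    fix N
    have "(\<Sum>u\<in>Basis. \<Sum>k\<in>square N. rcoeff (dir_deriv u (dir_deriv u \<eta>)) k / of_real (4 * pi\<^sup>2) * rcoeff f (- k))
        = (\<Sum>k\<in>square N. (\<Sum>u\<in>Basis. - of_real ((kdot k u)\<^sup>2)) * (rcoeff \<eta> k / of_real (4 * pi\<^sup>2) * rcoeff f (- k)))"
      unfolding sum_distrib_right
      by (subst sum.swap, intro sum.cong refl)
        (simp add: rcoeff_dir_deriv_twice[OF \<eta>])
    also have "\<dots> = (\<Sum>k\<in>square N. rcoeff \<eta> k / of_real (4 * pi\<^sup>2) * rcoeff h (- k))"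
      unfolding sum_negf of_real_sum[symmetric] sum_Basis_kdot_square coeff
      by (intro sum.cong refl) (simp add: ksq_def)
    finally show "(\<Sum>u\<in>Basis. \<Sum>k\<in>square N. rcoeff (dir_deriv u (dir_deriv u \<eta>)) k / of_real (4 * pi\<^sup>2) * rcoeff f (- k))
        = (\<Sum>k\<in>square N. rcoeff \<eta> k / of_real (4 * pi\<^sup>2) * rcoeff h (- k))" .
  qed
  ultimately have "(\<lambda>N. \<Sum>k\<in>square N. rcoeff \<eta> k / of_real (4 * pi\<^sup>2) * rcoeff h (- k))
      \<longlonglongrightarrow> of_real (torus_inner f (laplacian \<eta>))"
    by simp
  from LIMSEQ_unique[OF this torus_test_Parseval[OF torus_L2_integrable[OF h] \<eta>]]
  show "torus_inner f (laplacian \<eta>) = torus_inner h \<eta>" by simp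
qed (rule h)

section \<open>Real series and the inverse Laplacian\<close>

lemma series_real:
  assumes a: "(\<lambda>k. norm (a k)) summable_on UNIV" and "\<And>k. a (- k) = cnj (a k)"
  shows "of_real (Re (series a x)) = series a x"
proof -
  have "(\<Sum>k\<in>square N. a k * chr k x) = (\<Sum>k\<in>square N. cnj (a k * chr k x))" for N
    by (rule sum.reindex_bij_witness[of _ uminus uminus]) (simp_all add: assms(2) chr_uminus)
  then have "(\<lambda>N. \<Sum>k\<in>square N. a k * chr k x) = (\<lambda>N. cnj (\<Sum>k\<in>square N. a k * chr k x))"
    by simp
  then have "cnj (series a x) = series a x"
    using LIMSEQ_unique series_tendsto[OF a] tendsto_cnj[OF series_tendsto[OF a]]
    by (metis (no_types, lifting))
  then show ?thesis by (simp add: complex_eq_iff)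
qed

lemma rcoeff_Re_series:
  assumes a: "(\<lambda>k. norm (a k)) summable_on UNIV" and "\<And>k. a (- k) = cnj (a k)"
  shows "rcoeff (\<lambda>x. Re (series a x)) k = of_real (4 * pi\<^sup>2) * a k"
  unfolding rcoeff_def series_real[OF assms] by (rule fcoeff_series[OF a])

lemma torus_L2_Re_series:
  assumes a: "(\<lambda>k. norm (a k)) summable_on UNIV"
  shows "torus_L2 (\<lambda>x. Re (series a x))"
proof (rule torus_L2_bounded)
  show "(\<lambda>x. Re (series a x)) \<in> borel_measurable torus"
    using series_measurable[OF a] by measurable
  show "norm (Re (series a x)) \<le> (\<Sum>\<^sub>\<infinity>k. norm (a k))" for x
    using order_trans[OF abs_Re_le_cmod norm_series_le[OF a]] by simp
qed

text \<open>The coefficients of the derivative of \<open>\<Delta>\<^sup>-\<^sup>1 \<phi>\<close> in direction \<open>u\<close>, normalised so that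
  \<^const>\<open>series\<close> sums them back. At \<open>k = 0\<close> the value is \<open>0\<close>, whatever the junk value of the quotient.\<close>

definition grad_coeff :: "(real \<times> real \<Rightarrow> real) \<Rightarrow> real \<times> real \<Rightarrow> int \<times> int \<Rightarrow> complex" where
  "grad_coeff \<phi> u k = - (\<i> * of_real (kdot k u)) * rcoeff \<phi> k / of_real (ksq k) / of_real (4 * pi\<^sup>2)"

lemma summable_grad_coeff:
  assumes \<phi>: "torus_H1 \<phi>" and u: "u \<in> Basis"
  shows "(\<lambda>k. norm (grad_coeff \<phi> u k)) summable_on UNIV"
proof -
  obtain g where g: "weak_grad \<phi> g" and L2: "torus_L2 \<phi>" using \<phi> by (auto simp: torus_H1_def)
  have gu: "torus_L2 (\<lambda>x. g x \<bullet> u)"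
    using g u by (auto simp: weak_grad_def intro: torus_L2_inner_Basis)
  have "(\<lambda>k. norm (rcoeff (\<lambda>x. g x \<bullet> u) k / of_real (ksq k)) * (1 / (4 * pi\<^sup>2))) summable_on UNIV"
    by (intro summable_on_cmult_left abs_summable_divide_ksq[OF rcoeff_Bessel[OF gu]])
  then show ?thesis
    unfolding rcoeff_weak_grad[OF torus_L2_integrable[OF L2] g u] grad_coeff_def
    by (simp add: norm_divide norm_mult norm_power)
qed

text \<open>A witness is required for the choice in \<open>inv_laplacian\<close> to have its
  defining properties. Dividing the coefficients by -|k|^2 gives the solution, and the series of
  \<open>grad_coeff\<close> give its gradient; absolute convergence makes both bounded, hence square
  integrable.\<close>

lemma inv_laplacian_exists:
  assumes \<phi>: "torus_H1 \<phi>" and mean: "zero_mean \<phi>"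
  shows "\<exists>\<psi>. torus_H1 \<psi> \<and> zero_mean \<psi> \<and> weak_laplacian \<psi> \<phi>"
proof -
  have L2: "torus_L2 \<phi>" using \<phi> by (simp add: torus_H1_def)
  define b where "b k = - rcoeff \<phi> k / of_real (ksq k) / of_real (4 * pi\<^sup>2)" for k
  define \<psi> where "\<psi> x = Re (series b x)" for x
  define g where "g x = (\<Sum>u\<in>Basis. Re (series (grad_coeff \<phi> u) x) *\<^sub>R u)" for x
  have sym: "ksq (- k) = ksq k" for k by (simp add: ksq_def)
  have "(\<lambda>k. norm (rcoeff \<phi> k / of_real (ksq k)) * (1 / (4 * pi\<^sup>2))) summable_on UNIV"
    by (intro summable_on_cmult_left abs_summable_divide_ksq[OF rcoeff_Bessel[OF L2]])
  then have b: "(\<lambda>k. norm (b k)) summable_on UNIV"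
    by (simp add: b_def norm_divide norm_mult norm_power)
  have bsym: "b (- k) = cnj (b k)" for k by (simp add: b_def rcoeff_uminus sym)
  have \<psi>k: "rcoeff \<psi> k = of_real (4 * pi\<^sup>2) * b k" for k
    unfolding \<psi>_def[abs_def] by (rule rcoeff_Re_series[OF b bsym])
  have \<psi>2: "torus_L2 \<psi>" unfolding \<psi>_def[abs_def] by (rule torus_L2_Re_series[OF b])
  note \<psi>1 = torus_L2_integrable[OF \<psi>2]
  \<comment> \<open>The solvability condition: the Laplacian annihilates frequency 0, so
    \<open>\<phi>\<close> must have no component there.\<close>
  have 0: "rcoeff \<phi> 0 = 0" using mean by (simp add: rcoeff_0 zero_mean_def)
  have g_u: "(\<lambda>x. g x \<bullet> u) = (\<lambda>x. Re (series (grad_coeff \<phi> u) x))" if "u \<in> Basis" for u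
    using that by (auto simp: g_def fun_eq_iff inner_sum_left inner_Basis if_distrib cong: if_cong)
  have "weak_grad \<psi> g"
  proof (rule weak_gradI[OF \<psi>1])
    show "torus_L2 g"
    proof (rule torus_L2_bounded)
      show "g \<in> borel_measurable torus"
        unfolding g_def[abs_def]
        using series_measurable[OF summable_grad_coeff[OF \<phi>]] by measurable
      show "norm (g x) \<le> (\<Sum>u\<in>Basis. \<Sum>\<^sub>\<infinity>k. norm (grad_coeff \<phi> u k))" for x
        unfolding g_def
        by (intro order_trans[OF norm_sum] sum_mono)
          (use order_trans[OF abs_Re_le_cmod norm_series_le[OF summable_grad_coeff[OF \<phi>]]] in simp)
    qed
    fix u :: "real \<times> real" and k assume u: "u \<in> Basis"
    have "rcoeff (\<lambda>x. g x \<bullet> u) k = of_real (4 * pi\<^sup>2) * grad_coeff \<phi> u k"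
      unfolding g_u[OF u]
      by (rule rcoeff_Re_series[OF summable_grad_coeff[OF \<phi> u]])
        (simp add: grad_coeff_def rcoeff_uminus sym kdot_simps)
    then show "rcoeff (\<lambda>x. g x \<bullet> u) k = \<i> * of_real (kdot k u) * rcoeff \<psi> k"
      by (simp add: \<psi>k b_def grad_coeff_def)
  qed
  moreover have "zero_mean \<psi>"
    using \<psi>k[of 0] 0 by (simp add: rcoeff_0 zero_mean_def b_def)
  moreover have "weak_laplacian \<psi> \<phi>"
    by (rule weak_laplacianI[OF \<psi>2 L2]) (use 0 in \<open>auto simp: \<psi>k b_def\<close>)
  ultimately show ?thesis using \<psi>2 by (auto simp: torus_H1_def)
qed

lemma weak_grad_grad:
  assumes "torus_H1 f"
  shows "weak_grad f (grad f)"
  using assms unfolding grad_def torus_H1_def by (metis someI_ex)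

lemma inv_laplacian:
  assumes "torus_H1 \<phi>" "zero_mean \<phi>"
  shows "torus_H1 (inv_laplacian \<phi>)" "weak_laplacian (inv_laplacian \<phi>) \<phi>"
  using someI_ex[OF inv_laplacian_exists[OF assms]] unfolding inv_laplacian_def by auto

text \<open>Whichever representatives are chosen, the weak equations force the coefficients: the
  Laplacian fixes those of the potential for \<open>k \<noteq> 0\<close>, and the gradient
  multiplies them by \<open>kdot k u\<close>, which removes the one at 0.\<close>

lemma grad_inv_laplacian_eq_series:
  assumes \<phi>: "torus_H1 \<phi>" "zero_mean \<phi>" and u: "u \<in> Basis"
  shows "AE x in torus. of_real (grad (inv_laplacian \<phi>) x \<bullet> u) = series (grad_coeff \<phi> u) x"
proof (rule AE_eq_series[OF summable_grad_coeff[OF \<phi>(1) u]])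
  note \<psi> = inv_laplacian[OF \<phi>]
  have \<psi>1: "integrable torus (inv_laplacian \<phi>)"
    using \<psi>(1) by (auto simp: torus_H1_def dest: torus_L2_integrable)
  note g = weak_grad_grad[OF \<psi>(1)]
  show "integrable torus (\<lambda>x. complex_of_real (grad (inv_laplacian \<phi>) x \<bullet> u))"
    using g by (auto simp: weak_grad_def dest: torus_L2_integrable)
  fix k
  have "rcoeff (\<lambda>x. grad (inv_laplacian \<phi>) x \<bullet> u) k = of_real (4 * pi\<^sup>2) * grad_coeff \<phi> u k"
    using rcoeff_weak_grad[OF \<psi>1 g u, of k] rcoeff_weak_laplacian[OF \<psi>1 \<psi>(2), of k]
    by (cases "k = 0") (auto simp: grad_coeff_def kdot_simps)
  then show "fcoeff (\<lambda>x. of_real (grad (inv_laplacian \<phi>) x \<bullet> u)) k = of_real (4 * pi\<^sup>2) * grad_coeff \<phi> u k"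
    by (simp add: rcoeff_def)
qed

section \<open>Low and high modes of an orthonormal system\<close>

text \<open>The values are Euclidean vectors so that it applies to the \<open>\<phi> j\<close> and
  to their gradients alike.\<close>

lemma torus_inner_sum_scaleR:
  fixes f :: "nat \<Rightarrow> real \<times> real \<Rightarrow> 'a::euclidean_space"
  assumes "\<And>j. j \<in> J \<Longrightarrow> torus_L2 (f j)"
  shows "torus_inner (\<lambda>x. \<Sum>j\<in>J. a j *\<^sub>R f j x) (\<lambda>x. \<Sum>j\<in>J. a j *\<^sub>R f j x)
    = (\<Sum>i\<in>J. \<Sum>j\<in>J. a i * a j * torus_inner (f i) (f j))"
proof -
  have i: "integrable torus (\<lambda>x. a i * a j * (f i x \<bullet> f j x))" if "i \<in> J" "j \<in> J" for i j
    by (intro integrable_mult_right torus_L2_integrable_inner assms that)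
  have "torus_inner (\<lambda>x. \<Sum>j\<in>J. a j *\<^sub>R f j x) (\<lambda>x. \<Sum>j\<in>J. a j *\<^sub>R f j x)
      = (\<integral>x. (\<Sum>i\<in>J. \<Sum>j\<in>J. a i * a j * (f i x \<bullet> f j x)) \<partial>torus)"
    unfolding torus_inner_def by (simp add: inner_sum_left inner_sum_right sum_distrib_left mult_ac inner_commute)
  also have "\<dots> = (\<Sum>i\<in>J. \<Sum>j\<in>J. a i * a j * torus_inner (f i) (f j))"
    unfolding torus_inner_def
    by (subst Bochner_Integration.integral_sum, intro Bochner_Integration.integrable_sum i, assumption+,
        intro sum.cong refl, subst Bochner_Integration.integral_sum, intro i, assumption+,
        intro sum.cong refl, simp)
  finally show ?thesis .
qed

context
  fixes \<alpha> :: real and J :: "nat set" and \<phi> :: "nat \<Rightarrow> real \<times> real \<Rightarrow> real"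
  assumes \<alpha>: "\<alpha> \<ge> 0" and J: "finite J" and H1: "\<And>j. j \<in> J \<Longrightarrow> torus_H1 (\<phi> j)"
    and orth: "\<And>i j. i \<in> J \<Longrightarrow> j \<in> J \<Longrightarrow> H1_inner \<alpha> (\<phi> i) (\<phi> j) = (if i = j then 1 else 0)"
begin

lemma orthonormal_torus_L2: "j \<in> J \<Longrightarrow> torus_L2 (\<phi> j)"
  using H1 by (simp add: torus_H1_def)

lemma orthonormal_torus_L2_grad: "j \<in> J \<Longrightarrow> torus_L2 (grad (\<phi> j))"
  using weak_grad_grad[OF H1] by (simp add: weak_grad_def)

text \<open>Orthonormality says that the Gram matrix is the identity minus \<open>\<alpha>\<close>
  times the Gram matrix of the gradients, and the latter is positive semidefinite.\<close>

lemma orthonormal_gram_le: "(\<Sum>i\<in>J. \<Sum>j\<in>J. a i * a j * torus_inner (\<phi> i) (\<phi> j)) \<le> (\<Sum>j\<in>J. (a j)\<^sup>2)"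
proof -
  have "0 \<le> (\<Sum>i\<in>J. \<Sum>j\<in>J. a i * a j * torus_inner (grad (\<phi> i)) (grad (\<phi> j)))"
    by (subst torus_inner_sum_scaleR[symmetric]) (auto simp: orthonormal_torus_L2_grad torus_inner_def)
  then have "(\<Sum>i\<in>J. \<Sum>j\<in>J. a i * a j * torus_inner (\<phi> i) (\<phi> j))
      \<le> (\<Sum>i\<in>J. \<Sum>j\<in>J. a i * a j * torus_inner (\<phi> i) (\<phi> j))
        + \<alpha> * (\<Sum>i\<in>J. \<Sum>j\<in>J. a i * a j * torus_inner (grad (\<phi> i)) (grad (\<phi> j)))"
    using \<alpha> by simp
  also have "\<dots> = (\<Sum>i\<in>J. \<Sum>j\<in>J. a i * a j * H1_inner \<alpha> (\<phi> i) (\<phi> j))"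
    by (simp add: H1_inner_def sum_distrib_left sum.distrib[symmetric] algebra_simps)
  also have "\<dots> = (\<Sum>i\<in>J. \<Sum>j\<in>J. if i = j then (a i)\<^sup>2 else 0)"
    by (intro sum.cong refl) (simp add: orth power2_eq_square)
  also have "\<dots> = (\<Sum>j\<in>J. (a j)\<^sup>2)" using J by simp
  finally show ?thesis .
qed

text \<open>Expanding the square of \<open>f - w\<close> as usual, with the bound on the Gram matrix
  in place of the equality that holds for an orthonormal system.\<close>

lemma orthonormal_Bessel:
  assumes f: "torus_L2 f"
  shows "(\<Sum>j\<in>J. (torus_inner (\<phi> j) f)\<^sup>2) \<le> (\<integral>x. (f x)\<^sup>2 \<partial>torus)"
proof -
  define a where "a j = torus_inner (\<phi> j) f" for j
  define w where "w x = (\<Sum>j\<in>J. a j * \<phi> j x)" for x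
  have i: "integrable torus (\<lambda>x. a j * (\<phi> j x * f x))" if "j \<in> J" for j
    using torus_L2_integrable_inner[OF orthonormal_torus_L2[OF that] f] by simp
  have fw: "integrable torus (\<lambda>x. w x * f x)"
    unfolding w_def sum_distrib_right mult.assoc by (intro Bochner_Integration.integrable_sum i)
  have "(\<integral>x. w x * f x \<partial>torus) = (\<Sum>j\<in>J. \<integral>x. a j * (\<phi> j x * f x) \<partial>torus)"
    unfolding w_def sum_distrib_right mult.assoc by (intro Bochner_Integration.integral_sum i)
  also have "\<dots> = (\<Sum>j\<in>J. (a j)\<^sup>2)"
    by (simp add: power2_eq_square) (simp add: a_def torus_inner_def)
  finally have e1: "(\<integral>x. w x * f x \<partial>torus) = (\<Sum>j\<in>J. (a j)\<^sup>2)" .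
  have w2: "integrable torus (\<lambda>x. (w x)\<^sup>2)"
    unfolding w_def power2_eq_square sum_product
  proof (intro Bochner_Integration.integrable_sum)
    fix i j assume "i \<in> J" "j \<in> J"
    then have "integrable torus (\<lambda>x. a i * a j * (\<phi> i x \<bullet> \<phi> j x))"
      by (intro integrable_mult_right torus_L2_integrable_inner orthonormal_torus_L2)
    then show "integrable torus (\<lambda>x. a i * \<phi> i x * (a j * \<phi> j x))" by (simp add: mult_ac)
  qed
  have "(\<integral>x. (w x)\<^sup>2 \<partial>torus) = torus_inner (\<lambda>x. \<Sum>j\<in>J. a j *\<^sub>R \<phi> j x) (\<lambda>x. \<Sum>j\<in>J. a j *\<^sub>R \<phi> j x)"
    by (simp add: torus_inner_def w_def power2_eq_square)
  also have "\<dots> \<le> (\<Sum>j\<in>J. (a j)\<^sup>2)"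
    using orthonormal_gram_le by (subst torus_inner_sum_scaleR[OF orthonormal_torus_L2])
  finally have e2: "(\<integral>x. (w x)\<^sup>2 \<partial>torus) \<le> (\<Sum>j\<in>J. (a j)\<^sup>2)" .
  have f2: "integrable torus (\<lambda>x. (f x)\<^sup>2)" using f by (simp add: torus_L2_def)
  have "0 \<le> (\<integral>x. (f x - w x)\<^sup>2 \<partial>torus)" by simp
  also have "\<dots> = (\<integral>x. (f x)\<^sup>2 - 2 * (w x * f x) + (w x)\<^sup>2 \<partial>torus)"
    by (simp add: power2_diff algebra_simps)
  also have "\<dots> = (\<integral>x. (f x)\<^sup>2 \<partial>torus) - 2 * (\<integral>x. w x * f x \<partial>torus) + (\<integral>x. (w x)\<^sup>2 \<partial>torus)"
    using f2 fw w2 by simp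
  finally show ?thesis using e1 e2 by (simp add: a_def)
qed

text \<open>The inner sum is the pairing of \<open>\<phi> j\<close> with the fixed trigonometric
  polynomial \<open>q\<close>. Bessel's inequality is used for its real and imaginary parts, and the
  bound does not see the size of \<open>J\<close>.\<close>

lemma orthonormal_coeff_le:
  assumes A: "finite A"
  shows "(\<Sum>j\<in>J. (norm (\<Sum>k\<in>A. d k * rcoeff (\<phi> j) (- k)))\<^sup>2) \<le> 4 * pi\<^sup>2 * (\<Sum>k\<in>A. (norm (d k))\<^sup>2)"
proof -
  define q where "q x = (\<Sum>k\<in>A. d k * chr k x)" for x
  have cont: "continuous_on UNIV q" unfolding q_def by (intro continuous_intros)
  have z: "(norm (\<Sum>k\<in>A. d k * rcoeff (\<phi> j) (- k)))\<^sup>2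
      = (torus_inner (\<phi> j) (\<lambda>x. Re (q x)))\<^sup>2 + (torus_inner (\<phi> j) (\<lambda>x. Im (q x)))\<^sup>2" if j: "j \<in> J" for j
  proof -
    have f: "integrable torus (\<lambda>x. complex_of_real (\<phi> j x))" using torus_L2_integrable[OF orthonormal_torus_L2[OF j]] by simp
    note s = torus_integral_mult_sum_chr[OF f A, of d, folded q_def]
    have "(\<Sum>k\<in>A. d k * rcoeff (\<phi> j) (- k)) = (\<integral>x. of_real (\<phi> j x) * q x \<partial>torus)"
      by (simp add: s(2) rcoeff_def fcoeff_def)
    moreover have "Re (\<integral>x. of_real (\<phi> j x) * q x \<partial>torus) = torus_inner (\<phi> j) (\<lambda>x. Re (q x))"
      by (simp add: torus_inner_def flip: integral_Re[OF s(1)])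
    moreover have "Im (\<integral>x. of_real (\<phi> j x) * q x \<partial>torus) = torus_inner (\<phi> j) (\<lambda>x. Im (q x))"
      by (simp add: torus_inner_def flip: integral_Im[OF s(1)])
    ultimately show ?thesis by (simp add: cmod_power2)
  qed
  have c: "continuous_on UNIV (\<lambda>x. Re (q x))" "continuous_on UNIV (\<lambda>x. Im (q x))"
    by (intro continuous_intros cont)+
  have "(\<Sum>j\<in>J. (norm (\<Sum>k\<in>A. d k * rcoeff (\<phi> j) (- k)))\<^sup>2)
      = (\<Sum>j\<in>J. (torus_inner (\<phi> j) (\<lambda>x. Re (q x)))\<^sup>2) + (\<Sum>j\<in>J. (torus_inner (\<phi> j) (\<lambda>x. Im (q x)))\<^sup>2)"
    by (simp add: z sum.distrib)
  also have "\<dots> \<le> (\<integral>x. (Re (q x))\<^sup>2 \<partial>torus) + (\<integral>x. (Im (q x))\<^sup>2 \<partial>torus)"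
    by (intro add_mono orthonormal_Bessel torus_L2_continuous c)
  also have "\<dots> = (\<integral>x. (norm (q x))\<^sup>2 \<partial>torus)"
    unfolding cmod_power2
    by (intro Bochner_Integration.integral_add[symmetric] integrable_torus_continuous continuous_intros cont)
  also have "\<dots> = 4 * pi\<^sup>2 * (\<Sum>k\<in>A. (norm (d k))\<^sup>2)"
    unfolding q_def by (rule torus_integral_norm_sum_chr(2)[OF A])
  finally show ?thesis .
qed

text \<open>At a fixed \<open>x\<close> the characters are phases of modulus 1 and can be absorbed
  into the coefficients \<open>d\<close> of \<open>orthonormal_coeff_le\<close>. Summing over both
  directions turns the squares of \<open>kdot k u\<close> into \<open>ksq k\<close>, leaving
  1/|k|^2; the constant is 4 pi^2 * 8 / (16 pi^4).\<close>

lemma low_modes_le: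
  assumes "\<Lambda> \<ge> 1"
  shows "(\<Sum>(j, u)\<in>J \<times> Basis. (norm (\<Sum>k\<in>square \<Lambda>. grad_coeff (\<phi> j) u k * chr k x))\<^sup>2)
    \<le> 2 / pi\<^sup>2 * (1 + ln (real \<Lambda>))"
proof -
  \<comment> \<open>Written at \<open>- k\<close>, since \<open>orthonormal_coeff_le\<close> pairs
    \<open>d k\<close> with the coefficient at \<open>- k\<close>.\<close>
  define e where "e u k = - (\<i> * of_real (kdot (- k) u)) / of_real (ksq k) / of_real (4 * pi\<^sup>2) * chr (- k) x" for u k
  have sym: "ksq (- k) = ksq k" for k by (simp add: ksq_def)
  have *: "(\<Sum>k\<in>square \<Lambda>. grad_coeff (\<phi> j) u k * chr k x) = (\<Sum>k\<in>square \<Lambda>. e u k * rcoeff (\<phi> j) (- k))" for j u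
    by (rule sum.reindex_bij_witness[of _ uminus uminus]) (simp_all add: grad_coeff_def e_def sym)
  have ne: "(norm (e u k))\<^sup>2 = (kdot k u)\<^sup>2 * (1 / ((ksq k)\<^sup>2 * (16 * pi ^ 4)))" for u k
    by (simp add: e_def norm_mult norm_divide norm_power power_divide power_mult_distrib kdot_simps
        flip: power_mult)
  have "(\<Sum>(j, u)\<in>J \<times> Basis. (norm (\<Sum>k\<in>square \<Lambda>. grad_coeff (\<phi> j) u k * chr k x))\<^sup>2)
      = (\<Sum>u\<in>Basis. \<Sum>j\<in>J. (norm (\<Sum>k\<in>square \<Lambda>. e u k * rcoeff (\<phi> j) (- k)))\<^sup>2)"
    unfolding * by (subst sum.swap) (simp add: sum.cartesian_product)
  also have "\<dots> \<le> (\<Sum>u\<in>Basis. 4 * pi\<^sup>2 * (\<Sum>k\<in>square \<Lambda>. (norm (e u k))\<^sup>2))"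
    by (intro sum_mono orthonormal_coeff_le) simp
  also have "\<dots> = 4 * pi\<^sup>2 * (\<Sum>k\<in>square \<Lambda>. ksq k * (1 / ((ksq k)\<^sup>2 * (16 * pi ^ 4))))"
    unfolding sum_distrib_left[symmetric] ne
    by (subst sum.swap) (simp only: sum_distrib_right[symmetric] sum_Basis_kdot_square)
  also have "\<dots> = 1 / (4 * pi\<^sup>2) * (\<Sum>k\<in>square \<Lambda>. 1 / ksq k)"
    unfolding sum_distrib_left
    by (intro sum.cong refl) (simp add: power2_eq_square power4_eq_xxxx)
  also have "\<dots> \<le> 1 / (4 * pi\<^sup>2) * (8 * (1 + ln (real \<Lambda>)))"
    by (intro mult_left_mono sum_inverse_ksq_le assms) simp
  also have "\<dots> = 2 / pi\<^sup>2 * (1 + ln (real \<Lambda>))" by (simp add: field_simps)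
  finally show ?thesis .
qed

text \<open>Each pair (j, u) is estimated on its own, by Cauchy-Schwarz against 1/|k|^2. The bound
  is uniform in \<open>N\<close>, so the tail can be treated through finite sums.\<close>

lemma high_modes_le:
  assumes \<Lambda>: "\<Lambda> \<ge> 1" "\<Lambda> \<le> N"
  shows "(\<Sum>(j, u)\<in>J \<times> Basis. (norm (\<Sum>k\<in>square N - square \<Lambda>. grad_coeff (\<phi> j) u k * chr k x))\<^sup>2)
    \<le> 2 / (pi\<^sup>2 * real \<Lambda>) * (\<Sum>j\<in>J. (torus_norm (grad (\<phi> j)))\<^sup>2)"
proof -
  let ?A = "square N - square \<Lambda>"
  have *: "(norm (\<Sum>k\<in>?A. grad_coeff (\<phi> j) u k * chr k x))\<^sup>2
      \<le> 2 / (pi\<^sup>2 * real \<Lambda>) * (\<integral>x. (grad (\<phi> j) x \<bullet> u)\<^sup>2 \<partial>torus)"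
    if j: "j \<in> J" and u: "u \<in> Basis" for j u
  proof -
    let ?r = "rcoeff (\<lambda>x. grad (\<phi> j) x \<bullet> u)"
    have g: "torus_L2 (\<lambda>x. grad (\<phi> j) x \<bullet> u)"
      by (rule torus_L2_inner_Basis[OF orthonormal_torus_L2_grad[OF j] u])
    have "norm (\<Sum>k\<in>?A. grad_coeff (\<phi> j) u k * chr k x) \<le> (\<Sum>k\<in>?A. norm (grad_coeff (\<phi> j) u k))"
      by (rule order_trans[OF norm_sum]) (simp add: norm_mult)
    \<comment> \<open>Up to sign, \<open>grad_coeff\<close> is the coefficient of the derivative of
      \<open>\<phi> j\<close> along \<open>u\<close> divided by 4 pi^2 |k|^2: the derivative moves
      from the potential to \<open>\<phi> j\<close>.\<close>
    also have "\<dots> = (\<Sum>k\<in>?A. norm (?r k) * (1 / ksq k)) / (4 * pi\<^sup>2)"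
      unfolding grad_coeff_def rcoeff_weak_grad[OF torus_L2_integrable[OF orthonormal_torus_L2[OF j]] weak_grad_grad[OF H1[OF j]] u]
      by (simp add: norm_mult norm_divide norm_power sum_divide_distrib)
    finally have "(norm (\<Sum>k\<in>?A. grad_coeff (\<phi> j) u k * chr k x))\<^sup>2
        \<le> ((\<Sum>k\<in>?A. norm (?r k) * (1 / ksq k)) / (4 * pi\<^sup>2))\<^sup>2"
      by (intro power_mono) auto
    also have "\<dots> = (\<Sum>k\<in>?A. norm (?r k) * (1 / ksq k))\<^sup>2 * (1 / (16 * pi ^ 4))"
      by (simp add: power_divide power_mult_distrib flip: power_mult)
    also have "\<dots> \<le> ((\<Sum>k\<in>?A. (norm (?r k))\<^sup>2) * (\<Sum>k\<in>?A. (1 / ksq k)\<^sup>2)) * (1 / (16 * pi ^ 4))"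
      by (intro mult_right_mono Cauchy_Schwarz_ineq_sum) simp
    also have "\<dots> \<le> ((4 * pi\<^sup>2 * (\<integral>x. (grad (\<phi> j) x \<bullet> u)\<^sup>2 \<partial>torus)) * (8 * (1 / real \<Lambda>))) * (1 / (16 * pi ^ 4))"
    proof (intro mult_right_mono mult_mono rcoeff_Bessel g)
      have "(\<Sum>k\<in>?A. (1 / ksq k)\<^sup>2) \<le> 8 * (1 / real \<Lambda> - 1 / real N)"
        using sum_inverse_ksq_square_le[OF \<Lambda>] by (simp add: power_divide)
      also have "\<dots> \<le> 8 * (1 / real \<Lambda>)" by simp
      finally show "(\<Sum>k\<in>?A. (1 / ksq k)\<^sup>2) \<le> 8 * (1 / real \<Lambda>)" .
    qed (auto intro: sum_nonneg)
    also have "\<dots> = 2 / (pi\<^sup>2 * real \<Lambda>) * (\<integral>x. (grad (\<phi> j) x \<bullet> u)\<^sup>2 \<partial>torus)"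
      by (simp add: power2_eq_square power4_eq_xxxx)
    finally show ?thesis .
  qed
  have norm: "(torus_norm (grad (\<phi> j)))\<^sup>2 = (\<Sum>u\<in>Basis. \<integral>x. (grad (\<phi> j) x \<bullet> u)\<^sup>2 \<partial>torus)" if j: "j \<in> J" for j
  proof -
    have "(torus_norm (grad (\<phi> j)))\<^sup>2 = torus_inner (grad (\<phi> j)) (grad (\<phi> j))"
      unfolding torus_norm_def by (rule real_sqrt_pow2) (simp add: torus_inner_def)
    also have "\<dots> = (\<integral>x. (\<Sum>u\<in>Basis. (grad (\<phi> j) x \<bullet> u)\<^sup>2) \<partial>torus)"
      unfolding torus_inner_def
      by (intro Bochner_Integration.integral_cong refl, subst euclidean_inner) (simp add: power2_eq_square)
    also have "\<dots> = (\<Sum>u\<in>Basis. \<integral>x. (grad (\<phi> j) x \<bullet> u)\<^sup>2 \<partial>torus)"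
      using torus_L2_inner_Basis[OF orthonormal_torus_L2_grad[OF j]]
      by (intro Bochner_Integration.integral_sum) (simp add: torus_L2_def)
    finally show ?thesis .
  qed
  have "(\<Sum>(j, u)\<in>J \<times> Basis. (norm (\<Sum>k\<in>?A. grad_coeff (\<phi> j) u k * chr k x))\<^sup>2)
      \<le> (\<Sum>(j, u)\<in>J \<times> Basis. 2 / (pi\<^sup>2 * real \<Lambda>) * (\<integral>x. (grad (\<phi> j) x \<bullet> u)\<^sup>2 \<partial>torus))"
    unfolding case_prod_unfold by (intro sum_mono * ) (simp_all add: mem_Times_iff)
  also have "\<dots> = 2 / (pi\<^sup>2 * real \<Lambda>) * (\<Sum>j\<in>J. (torus_norm (grad (\<phi> j)))\<^sup>2)"
    by (simp add: sum.cartesian_product[symmetric] sum_distrib_left norm)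
  finally show ?thesis .
qed

text \<open>Minkowski's inequality is that of the finite-dimensional space indexed by pairs (j, u),
  applied to truncations at \<open>square N\<close>; the bound survives the limit in
  \<open>N\<close>.\<close>

lemma sum_norm_series_le:
  assumes \<Lambda>: "\<Lambda> \<ge> 1"
  shows "(\<Sum>(j, u)\<in>J \<times> Basis. (norm (series (grad_coeff (\<phi> j) u) x))\<^sup>2)
    \<le> (sqrt (2 / pi\<^sup>2 * (1 + ln (real \<Lambda>)))
      + sqrt (2 / (pi\<^sup>2 * real \<Lambda>) * (\<Sum>j\<in>J. (torus_norm (grad (\<phi> j)))\<^sup>2)))\<^sup>2"
    (is "_ \<le> (?l + ?h)\<^sup>2")
proof (rule LIMSEQ_le_const2)
  let ?P = "\<lambda>A (j, u). norm (\<Sum>k\<in>A. grad_coeff (\<phi> j) u k * chr k x)"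
  show "(\<lambda>N. \<Sum>(j, u)\<in>J \<times> Basis. (norm (\<Sum>k\<in>square N. grad_coeff (\<phi> j) u k * chr k x))\<^sup>2)
      \<longlonglongrightarrow> (\<Sum>(j, u)\<in>J \<times> Basis. (norm (series (grad_coeff (\<phi> j) u) x))\<^sup>2)"
    unfolding case_prod_unfold
    by (intro tendsto_sum tendsto_power tendsto_norm series_tendsto summable_grad_coeff) (auto simp: H1)
  have "(\<Sum>(j, u)\<in>J \<times> Basis. (norm (\<Sum>k\<in>square N. grad_coeff (\<phi> j) u k * chr k x))\<^sup>2) \<le> (?l + ?h)\<^sup>2"
    if N: "N \<ge> \<Lambda>" for N
  proof -
    have "L2_set (?P (square N)) (J \<times> Basis)
        \<le> L2_set (\<lambda>p. ?P (square \<Lambda>) p + ?P (square N - square \<Lambda>) p) (J \<times> Basis)"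
    proof (rule L2_set_mono; clarify)
      fix j and u :: "real \<times> real"
      have eq: "(\<Sum>k\<in>square N. grad_coeff (\<phi> j) u k * chr k x)
          = (\<Sum>k\<in>square N - square \<Lambda>. grad_coeff (\<phi> j) u k * chr k x) + (\<Sum>k\<in>square \<Lambda>. grad_coeff (\<phi> j) u k * chr k x)"
        by (rule sum.subset_diff[OF square_mono[OF N]]) simp
      show "norm (\<Sum>k\<in>square N. grad_coeff (\<phi> j) u k * chr k x)
          \<le> norm (\<Sum>k\<in>square \<Lambda>. grad_coeff (\<phi> j) u k * chr k x) + norm (\<Sum>k\<in>square N - square \<Lambda>. grad_coeff (\<phi> j) u k * chr k x)"
        unfolding eq by (rule order_trans[OF norm_triangle_ineq]) simp
    qed simp
    also have "\<dots> \<le> L2_set (?P (square \<Lambda>)) (J \<times> Basis) + L2_set (?P (square N - square \<Lambda>)) (J \<times> Basis)"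
      by (rule L2_set_triangle_ineq)
    also have "\<dots> \<le> ?l + ?h"
      unfolding L2_set_def
      using low_modes_le[OF \<Lambda>, of x] high_modes_le[OF \<Lambda> N, of x]
      by (intro add_mono real_sqrt_le_mono) (simp_all add: case_prod_unfold)
    finally have "L2_set (?P (square N)) (J \<times> Basis) \<le> ?l + ?h" .
    then have "(L2_set (?P (square N)) (J \<times> Basis))\<^sup>2 \<le> (?l + ?h)\<^sup>2"
      by (rule power_mono) (rule L2_set_nonneg)
    then show ?thesis
      unfolding L2_set_def by (simp add: case_prod_unfold sum_nonneg)
  qed
  then show "\<exists>M. \<forall>N\<ge>M. (\<Sum>(j, u)\<in>J \<times> Basis. (norm (\<Sum>k\<in>square N. grad_coeff (\<phi> j) u k * chr k x))\<^sup>2)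
      \<le> (?l + ?h)\<^sup>2"
    by (intro exI[of _ \<Lambda>] allI impI)
qed

end

text \<open>Finiteness is claimed explicitly because \<open>real_of_ereal\<close> maps \<infinity>
  to 0, which would make the estimate trivially true for an unbounded \<open>\<rho>\<close>.\<close>

theorem proposition4p2:
  fixes \<alpha> :: real and n \<Lambda> :: nat
    and \<phi> :: "nat \<Rightarrow> real \<times> real \<Rightarrow> real"
    and v :: "nat \<Rightarrow> real \<times> real \<Rightarrow> real \<times> real"
    and \<rho> :: "real \<times> real \<Rightarrow> real"
  assumes "\<alpha> \<ge> 0"
    and "\<And>j. j \<in> {1..n} \<Longrightarrow> torus_H1 (\<phi> j)"
    and "\<And>j. j \<in> {1..n} \<Longrightarrow> zero_mean (\<phi> j)"
    and "\<And>i j. i \<in> {1..n} \<Longrightarrow> j \<in> {1..n} \<Longrightarrow> H1_inner \<alpha> (\<phi> i) (\<phi> j) = (if i = j then 1 else 0)"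
    and "\<And>j. j \<in> {1..n} \<Longrightarrow> v j = grad_perp (inv_laplacian (\<phi> j))"
    and "\<And>x. \<rho> x = (\<Sum>j = 1..n. (norm (v j x))\<^sup>2)"
    and "\<Lambda> \<ge> 1"
  shows "torus_Linf_norm \<rho> < \<infinity> \<and>
    sqrt (real_of_ereal (torus_Linf_norm \<rho>))
      \<le> 4 * sqrt 2 * pi * sqrt (ln (4 * exp 1 * real \<Lambda>))
        + 4 * real \<Lambda> powr (- 1 / 2)
            * sqrt (measure torus (space torus) * (\<Sum>j = 1..n. (torus_norm (grad (\<phi> j)))\<^sup>2))"
proof -
  define S where "S = (\<Sum>j = 1..n. (torus_norm (grad (\<phi> j)))\<^sup>2)"
  define l where "l = sqrt (2 / pi\<^sup>2 * (1 + ln (real \<Lambda>)))"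
  define h where "h = sqrt (2 / (pi\<^sup>2 * real \<Lambda>) * S)"
  have S: "S \<ge> 0" unfolding S_def by (intro sum_nonneg) simp
  have lh: "l \<ge> 0" "h \<ge> 0"
    using S assms(7) by (simp_all add: l_def h_def)
  let ?\<psi> = "\<lambda>j. grad (inv_laplacian (\<phi> j))"
  have \<rho>: "\<rho> x = (\<Sum>j = 1..n. (norm (?\<psi> j x))\<^sup>2)" for x
    unfolding assms(6) by (intro sum.cong refl) (simp add: assms(5) grad_perp_def norm_perp)
  have "AE x in torus. \<forall>j\<in>{1..n}. \<forall>u\<in>Basis. of_real (?\<psi> j x \<bullet> u) = series (grad_coeff (\<phi> j) u) x"
    by (intro AE_finite_allI finite_atLeastAtMost finite_Basis grad_inv_laplacian_eq_series assms(2,3))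
  then have AE: "AE x in torus. ereal \<bar>\<rho> x\<bar> \<le> ereal ((l + h)\<^sup>2)"
  proof eventually_elim
    case (elim x)
    have "\<rho> x = (\<Sum>j = 1..n. \<Sum>u\<in>Basis. (?\<psi> j x \<bullet> u)\<^sup>2)"
      unfolding \<rho> power2_norm_eq_inner by (subst euclidean_inner) (simp add: power2_eq_square)
    also have "\<dots> = (\<Sum>j = 1..n. \<Sum>u\<in>Basis. (norm (series (grad_coeff (\<phi> j) u) x))\<^sup>2)"
    proof (intro sum.cong refl)
      fix j and u :: "real \<times> real" assume "j \<in> {1..n}" "u \<in> Basis"
      then have "series (grad_coeff (\<phi> j) u) x = of_real (?\<psi> j x \<bullet> u)" using elim by simp
      then show "(?\<psi> j x \<bullet> u)\<^sup>2 = (norm (series (grad_coeff (\<phi> j) u) x))\<^sup>2" by simp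
    qed
    also have "\<dots> = (\<Sum>(j, u)\<in>{1..n} \<times> Basis. (norm (series (grad_coeff (\<phi> j) u) x))\<^sup>2)"
      by (rule sum.cartesian_product)
    also have "\<dots> \<le> (l + h)\<^sup>2"
      unfolding l_def h_def S_def
      by (rule sum_norm_series_le[OF assms(1) finite_atLeastAtMost assms(2) assms(4) assms(7)])
    finally have "\<rho> x \<le> (l + h)\<^sup>2" .
    moreover have "\<rho> x \<ge> 0" unfolding \<rho> by (intro sum_nonneg) simp
    ultimately show ?case by simp
  qed
  \<comment> \<open>Measurability has to be checked because \<open>esssup_I\<close> asks for it
    besides the bound almost everywhere.\<close>
  have "?\<psi> j \<in> borel_measurable torus" if "j \<in> {1..n}" for j
    using weak_grad_grad[OF inv_laplacian(1)[OF assms(2,3)[OF that]]]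
    by (simp add: weak_grad_def torus_L2_def)
  then have "\<rho> \<in> borel_measurable torus"
    unfolding \<rho>[abs_def]
    by (intro borel_measurable_sum borel_measurable_power measurable_compose[OF _ borel_measurable_norm])
  then have "(\<lambda>x. ereal \<bar>\<rho> x\<bar>) \<in> borel_measurable torus" by measurable
  then have le: "torus_Linf_norm \<rho> \<le> ereal ((l + h)\<^sup>2)"
    unfolding torus_Linf_norm_def by (rule esssup_I[OF _ AE])
  have "real_of_ereal (torus_Linf_norm \<rho>) \<le> (l + h)\<^sup>2"
    \<comment> \<open>The value \<infinity> is excluded by \<open>le\<close>; for -\<infinity> the
      function \<open>real_of_ereal\<close> gives 0, which is below any square.\<close>
    using le by (cases "torus_Linf_norm \<rho>") auto
  then have "sqrt (real_of_ereal (torus_Linf_norm \<rho>)) \<le> sqrt ((l + h)\<^sup>2)" by (rule real_sqrt_le_mono)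
  also have "\<dots> = l + h" using lh by simp
  \<comment> \<open>Compare 2/pi^2 with 32 pi^2, the square of the stated constant, and 1 + ln
    \<Lambda> = ln (e \<Lambda>) with ln (4 e \<Lambda>).\<close>
  also have "l \<le> 4 * sqrt 2 * pi * sqrt (ln (4 * exp 1 * real \<Lambda>))"
  proof -
    have pi1: "1 \<le> pi\<^sup>2" using pi_ge_two by (intro one_le_power) linarith
    have "2 / pi\<^sup>2 \<le> 2 / 1" using pi1 by (intro divide_left_mono) auto
    also have "2 / 1 \<le> 32 * pi\<^sup>2" using pi1 by simp
    finally have "2 / pi\<^sup>2 \<le> 32 * pi\<^sup>2" .
    moreover have "1 + ln (real \<Lambda>) \<le> ln (4 * exp 1 * real \<Lambda>)"
      using assms(7) by (simp add: ln_mult)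
    ultimately have "2 / pi\<^sup>2 * (1 + ln (real \<Lambda>)) \<le> 32 * pi\<^sup>2 * ln (4 * exp 1 * real \<Lambda>)"
      using assms(7) by (intro mult_mono) auto
    then have "l \<le> sqrt (32 * pi\<^sup>2 * ln (4 * exp 1 * real \<Lambda>))" unfolding l_def by (rule real_sqrt_le_mono)
    also have "\<dots> = sqrt (4\<^sup>2 * 2) * pi * sqrt (ln (4 * exp 1 * real \<Lambda>))"
      by (simp add: real_sqrt_mult)
    also have "sqrt (4\<^sup>2 * 2) = 4 * sqrt 2" by (simp only: real_sqrt_mult) simp
    finally show ?thesis .
  qed
  \<comment> \<open>Here 2/pi^2 is compared with 64 pi^2, the product of 4^2 and the area 4 pi^2 of
    the torus.\<close>
  also have "h \<le> 4 * real \<Lambda> powr (- 1 / 2) * sqrt (measure torus (space torus) * S)"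
  proof -
    have pi1: "1 \<le> pi\<^sup>2" using pi_ge_two by (intro one_le_power) linarith
    have "2 / pi\<^sup>2 \<le> 2 / 1" using pi1 by (intro divide_left_mono) auto
    also have "2 / 1 \<le> 64 * pi\<^sup>2" using pi1 by simp
    finally have "2 / pi\<^sup>2 * (S / real \<Lambda>) \<le> 64 * pi\<^sup>2 * (S / real \<Lambda>)"
      using S by (intro mult_right_mono) auto
    then have "h \<le> sqrt (4\<^sup>2 * (1 / real \<Lambda>) * (4 * pi\<^sup>2 * S))"
      unfolding h_def by (intro real_sqrt_le_mono) simp
    also have "\<dots> = 4 * sqrt (1 / real \<Lambda>) * sqrt (4 * pi\<^sup>2 * S)"
      by (simp only: real_sqrt_mult) simp
    also have "sqrt (1 / real \<Lambda>) = real \<Lambda> powr (- 1 / 2)"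
      unfolding minus_divide_left[symmetric] powr_minus
      by (simp add: powr_half_sqrt real_sqrt_divide inverse_eq_divide)
    finally show ?thesis by (simp add: measure_space_torus)
  qed
  finally have "sqrt (real_of_ereal (torus_Linf_norm \<rho>))
      \<le> 4 * sqrt 2 * pi * sqrt (ln (4 * exp 1 * real \<Lambda>))
        + 4 * real \<Lambda> powr (- 1 / 2) * sqrt (measure torus (space torus) * S)"
    by simp
  then show ?thesis
    using le by (auto simp: S_def intro: le_less_trans)
qed

end
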